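(* $$\limsup_{n\to\infty}\ \frac{\Psi(n)}{(\log\log n)^2(\log\log\log n)}\,=\,e^{\gamma}.$$
   Context: For a positive integer $n$, $\Psi(n)=\sum_{d\mid n}\frac{(\log d)(\log\log d)}{d}$, the sum being over the positive divisors $d$ of $n$. Here $\gamma$ is Euler's constant. Convention: $\log\log x$ equals $1$ if $0\le x\le e^{e}$, and equals $\log\log x$ in the usual sense if $x>e^{e}$; $\log\log\log x$ equals $1$ if $0\le x\le e^{e^{e}}$, and equals $\log\log\log x$ in the usual sense if $x>e^{e^{e}}$. *)

theory Defs
  imports "HOL-Analysis.Analysis"
begin

(* Truncated iterated logarithms: both are only applied to nonnegative arguments. *)

definition loglog :: "real \<Rightarrow> real" where
  "loglog x = (if x \<le> exp (exp 1) then 1 else ln (ln x))"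

definition logloglog :: "real \<Rightarrow> real" where
  "logloglog x = (if x \<le> exp (exp (exp 1)) then 1 else ln (ln (ln x)))"

(* Meant for n > 0 only; there every divisor is positive and the index set is finite. *)
definition Psi :: "nat \<Rightarrow> real" where
  "Psi n = (\<Sum>d | d dvd n. ln (real d) * loglog (real d) / real d)"

end

theory Submission
  imports Defs "HOL-Number_Theory.Prime_Powers" "HOL-Real_Asymp.Real_Asymp"
begin

text \<open>
  Give every divisor \<open>d\<close> of \<open>n\<close> the weight \<open>1 / d\<close> and write \<open>S\<^sub>j(n)\<close> for the sum of \<open>(ln d)\<^sup>j / d\<close>
  over \<open>d dvd n\<close> (\<open>divisor_moment j n\<close>). Under these weights the exponents of the different primes
  in \<open>d\<close> are independent truncated geometric variables, so that \<open>S\<^sub>0(n)\<close> is a product over the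
  primes dividing \<open>n\<close>, \<open>S\<^sub>1(n) / S\<^sub>0(n)\<close> is a sum of means, each close to \<open>ln p / p\<close>, and
  \<open>S\<^sub>2(n) / S\<^sub>0(n)\<close> is at most the square of that sum plus a sum of second moments.

  The iterated logarithm is removed by two tangent inequalities. As \<open>ln\<close> is concave,
  \<open>ln t \<le> ln T + t / T\<close>; as \<open>t ln t\<close> is convex, \<open>t ln t \<ge> t ln T - T\<close>. With \<open>t = ln d\<close>
  and \<open>T\<close> close to \<open>ln (ln n)\<close>, they compare \<open>Psi n\<close> with \<open>ln T * S\<^sub>1(n)\<close> up to errors
  \<open>S\<^sub>1(n) + S\<^sub>2(n) / T\<close> and \<open>T * S\<^sub>0(n)\<close>, both of order \<open>T\<^sup>2\<close> in the relevant range
  (\<open>Psi_upper\<close>, \<open>Psi_lower\<close>).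

  So the claim reduces to two facts about primes: the sum of \<open>ln p / p\<close> over \<open>p \<le> x\<close> is
  \<open>ln x + O(1)\<close>, and the product of \<open>1 / (1 - 1 / p)\<close> over \<open>p \<le> x\<close> is asymptotic to
  \<open>e\<^sup>\<gamma> ln x\<close>. These are the first and the third theorem of Mertens. Only \<open>x = 2\<^sup>J\<close> is
  ever needed, and restricting to these values shortens the proofs: Chebyshev's bound is
  one application of the central binomial coefficient per dyadic block, and the constant
  \<open>\<gamma>\<close> comes straight from harmonic numbers. Namely, let \<open>b\<^sub>j\<close> be the sum of
  \<open>- ln (1 - 1 / p)\<close> over the dyadic block \<open>2\<^sup>j < p \<le> 2\<^sup>j * 2\<close>. Mertens' first theorem and
  partial summation show that the series of \<open>b\<^sub>j - 1 / (j + 1)\<close> converges to some \<open>l\<close>.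
  Abel's limit theorem computes \<open>l\<close>: with \<open>z = 2 powr (- \<delta>)\<close>, the power series of \<open>b\<^sub>j\<close>
  is \<open>ln (1 / \<delta>) + o(1)\<close> by the Euler product, since \<open>\<Sum>m. m powr (-1 - \<delta>)\<close> lies between
  \<open>1 / \<delta>\<close> and \<open>1 + 1 / \<delta>\<close>, while that of \<open>1 / (j + 1)\<close> is \<open>- ln (1 - z)\<close>; hence \<open>l = ln (ln 2)\<close>.

  For the upper bound choose \<open>J\<close> with \<open>2\<^sup>J\<close> between \<open>ln n\<close> and \<open>2 * ln n\<close>. At most \<open>2\<^sup>J / (J ln 2)\<close> primes
  beyond \<open>2\<^sup>J\<close> divide \<open>n\<close>, too few to affect a leading term, and the smaller primes are
  controlled by the theorems of Mertens. For the lower bound take \<open>n\<close> to be the product of \<open>p ^ (2 * j)\<close> over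
  \<open>p \<le> 2\<^sup>j\<close>: the exponent \<open>2 * j\<close> makes \<open>S\<^sub>0(n)\<close> nearly the full Euler product, but it is so
  small that \<open>ln (ln n)\<close> is still asymptotic to \<open>j ln 2\<close>.
\<close>

section \<open>Moments of the logarithm over the divisors of a number\<close>

text \<open>Every divisor of \<open>p ^ k * m\<close> is \<open>p ^ i * e\<close> for a unique \<open>i \<le> k\<close> and a unique divisor \<open>e\<close> of
\<open>m\<close>. All product formulas over divisors below follow from this by adding one prime at a time.\<close>

lemma sum_divisors_prime_power_mult:
  fixes f :: "nat \<Rightarrow> real"
  assumes p: "prime p" and pm: "\<not> p dvd m"
  shows "(\<Sum>d | d dvd p ^ k * m. f d) = (\<Sum>i\<le>k. \<Sum>e | e dvd m. f (p ^ i * e))"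
proof -
  have m0: "m \<noteq> 0" using pm by (metis dvd_0_right)
  have p0: "p > 0" using p prime_gt_0_nat by blast
  have "bij_betw (\<lambda>(i,e). p ^ i * e) ({..k} \<times> {e. e dvd m}) {d. d dvd p ^ k * m}"
    unfolding bij_betw_def
  proof
    show "inj_on (\<lambda>(i,e). p ^ i * e) ({..k} \<times> {e. e dvd m})"
    proof (rule inj_onI, clarsimp)
      fix i e j e'
      assume e: "e dvd m" "e' dvd m" and eq: "p ^ i * e = p ^ j * e'"
      have nd: "\<not> p dvd e" "\<not> p dvd e'" using e pm dvd_trans by blast+
      have "multiplicity p (p ^ i * e) = i" "multiplicity p (p ^ j * e') = j"
        using nd p multiplicity_prime_elem_times_other not_dvd_imp_multiplicity_0
        by (metis add_cancel_right_right dvd_0_right multiplicity_same_power p0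
            prime_elem_multiplicity_mult_distrib neq0_conv prime_imp_prime_elem
            not_prime_unit power_not_zero)+
      hence "i = j" using eq by simp
      thus "i = j \<and> e = e'" using eq p0 by simp
    qed
    show "(\<lambda>(i,e). p ^ i * e) ` ({..k} \<times> {e. e dvd m}) = {d. d dvd p ^ k * m}"
    proof (intro equalityI subsetI)
      fix d assume "d \<in> (\<lambda>(i,e). p ^ i * e) ` ({..k} \<times> {e. e dvd m})"
      thus "d \<in> {d. d dvd p ^ k * m}" by (auto intro!: mult_dvd_mono le_imp_power_dvd)
    next
      fix d assume "d \<in> {d. d dvd p ^ k * m}"
      then obtain a b where ab: "d = a * b" "a dvd p ^ k" "b dvd m"
        using division_decomp by blast
      obtain i where "i \<le> k" "a = p ^ i" using ab(2) p divides_primepow_nat by blast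
      thus "d \<in> (\<lambda>(i,e). p ^ i * e) ` ({..k} \<times> {e. e dvd m})" using ab by auto
    qed
  qed
  from sum.reindex_bij_betw[OF this, of f]
  have "(\<Sum>d | d dvd p ^ k * m. f d) = (\<Sum>(i,e)\<in>{..k} \<times> {e. e dvd m}. f (p ^ i * e))"
    by (simp add: case_prod_unfold)
  also have "\<dots> = (\<Sum>i\<le>k. \<Sum>e | e dvd m. f (p ^ i * e))"
    by (rule sum.cartesian_product[symmetric])
  finally show ?thesis .
qed

lemma not_dvd_prod_prime_powers:
  fixes p :: nat
  assumes "finite A" "\<And>q. q \<in> A \<Longrightarrow> prime q" "prime p" "p \<notin> A"
  shows "\<not> p dvd (\<Prod>q\<in>A. q ^ k q)"
  using assms by (metis prime_dvd_power prime_dvd_prod_iff primes_dvd_imp_eq)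

definition divisor_moment :: "nat \<Rightarrow> nat \<Rightarrow> real" where
  "divisor_moment j n = (\<Sum>d | d dvd n. ln (real d) ^ j / real d)"

definition exponent_moment :: "nat \<Rightarrow> nat \<Rightarrow> nat \<Rightarrow> real" where
  "exponent_moment j p k = (\<Sum>i\<le>k. real i ^ j * (1 / real p) ^ i)"

lemma euler_product_divisors:
  fixes s :: real and k :: "nat \<Rightarrow> nat"
  assumes "finite A" "\<And>p. p \<in> A \<Longrightarrow> prime p"
  shows "(\<Sum>d | d dvd (\<Prod>p\<in>A. p ^ k p). real d powr s) = (\<Prod>p\<in>A. \<Sum>i\<le>k p. (real p powr s) ^ i)"
  using assms
proof (induction A rule: finite_induct)
  case empty
  then show ?case by simp
next
  case (insert p A)
  let ?m = "\<Prod>p\<in>A. p ^ k p"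
  have p: "prime p" "p > 0" using insert prime_gt_0_nat by auto
  have nd: "\<not> p dvd ?m" using insert by (intro not_dvd_prod_prime_powers) auto
  have pw: "real (p ^ i * e) powr s = (real p powr s) ^ i * real e powr s" for i e
    using p by (simp add: powr_mult powr_powr mult.commute flip: powr_realpow)
  have "(\<Sum>d | d dvd (\<Prod>p\<in>insert p A. p ^ k p). real d powr s)
      = (\<Sum>i\<le>k p. \<Sum>e | e dvd ?m. real (p ^ i * e) powr s)"
    using insert sum_divisors_prime_power_mult[OF p(1) nd, of "\<lambda>d. real d powr s"] by simp
  also have "\<dots> = (\<Sum>i\<le>k p. (real p powr s) ^ i) * (\<Sum>e | e dvd ?m. real e powr s)"
    unfolding pw by (simp add: sum_distrib_left[symmetric] sum_distrib_right[symmetric])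
  finally show ?case using insert by simp
qed

lemma exponent_moment_0_ge1: "exponent_moment 0 p k \<ge> 1"
proof -
  have "(\<Sum>i\<in>{0}. (1 / real p) ^ i) \<le> (\<Sum>i\<le>k. (1 / real p) ^ i)"
    by (rule sum_mono2) auto
  thus ?thesis by (simp add: exponent_moment_def)
qed

lemma divisor_moment_0_prod:
  fixes k :: "nat \<Rightarrow> nat"
  assumes "finite A" "\<And>p. p \<in> A \<Longrightarrow> prime p"
  shows "divisor_moment 0 (\<Prod>p\<in>A. p ^ k p) = (\<Prod>p\<in>A. exponent_moment 0 p (k p))"
proof -
  have "real d powr - 1 = 1 / real d" for d
    by (cases "d = 0") (auto simp: powr_minus_divide)
  thus ?thesis
    using euler_product_divisors[OF assms, where k = k and s = "-1"]
    by (simp add: divisor_moment_def exponent_moment_def)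
qed

text \<open>Here \<open>ln (p ^ i * e) = i * ln p + ln e\<close>; the three formulas are the binomial expansions of its
powers, in which the two independent factors separate.\<close>

lemma divisor_moment_prime_power_mult:
  assumes p: "prime p" and nd: "\<not> p dvd m" 
  shows "divisor_moment 0 (p ^ k * m) = exponent_moment 0 p k * divisor_moment 0 m"
    and "divisor_moment 1 (p ^ k * m) = exponent_moment 0 p k * divisor_moment 1 m
           + ln (real p) * exponent_moment 1 p k * divisor_moment 0 m"
    and "divisor_moment 2 (p ^ k * m) = exponent_moment 0 p k * divisor_moment 2 m
           + 2 * ln (real p) * exponent_moment 1 p k * divisor_moment 1 m
           + ln (real p) ^ 2 * exponent_moment 2 p k * divisor_moment 0 m"
proof -
  have p0: "p > 0" using p prime_gt_0_nat by auto
  have m0: "m \<noteq> 0" using nd by (metis dvd_0_right)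
  have ln: "ln (real (p ^ i * e)) = real i * ln (real p) + ln (real e)" if "e dvd m" for i e
  proof -
    have "e > 0" using that m0 by (auto intro: Nat.gr0I)
    thus ?thesis using p0 by (simp add: ln_mult ln_realpow)
  qed
  define q where "q = 1 / real p"
  have dm: "divisor_moment j (p ^ k * m)
      = (\<Sum>i\<le>k. \<Sum>e | e dvd m. (real i * ln (real p) + ln (real e)) ^ j * (q ^ i / real e))" for j
  proof -
    have "divisor_moment j (p ^ k * m) = (\<Sum>i\<le>k. \<Sum>e | e dvd m. ln (real (p ^ i * e)) ^ j / real (p ^ i * e))"
      unfolding divisor_moment_def by (rule sum_divisors_prime_power_mult[OF p nd])
    also have "\<dots> = (\<Sum>i\<le>k. \<Sum>e | e dvd m. (real i * ln (real p) + ln (real e)) ^ j * (q ^ i / real e))"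
      by (intro sum.cong refl, subst ln) (simp_all add: q_def power_one_over)
    finally show ?thesis .
  qed
  have prod: "(\<Sum>i\<le>k. \<Sum>e | e dvd m. (real i ^ a * q ^ i) * (ln (real e) ^ b / real e))
      = exponent_moment a p k * divisor_moment b m" for a b
    unfolding exponent_moment_def divisor_moment_def q_def by (rule sum_product[symmetric])
  show "divisor_moment 0 (p ^ k * m) = exponent_moment 0 p k * divisor_moment 0 m"
    using prod[of 0 0] by (simp add: dm)
  have "divisor_moment 1 (p ^ k * m)
     = (\<Sum>i\<le>k. \<Sum>e | e dvd m. (real i ^ 0 * q ^ i) * (ln (real e) ^ 1 / real e)
          + ln (real p) * ((real i ^ 1 * q ^ i) * (ln (real e) ^ 0 / real e)))"
    unfolding dm by (intro sum.cong refl) (simp add: algebra_simps add_divide_distrib)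
  also have "\<dots> = exponent_moment 0 p k * divisor_moment 1 m
           + ln (real p) * (exponent_moment 1 p k * divisor_moment 0 m)"
    by (simp only: sum.distrib sum_distrib_left[symmetric] sum_distrib_right[symmetric]
          exponent_moment_def divisor_moment_def q_def)
  finally show "divisor_moment 1 (p ^ k * m) = exponent_moment 0 p k * divisor_moment 1 m
           + ln (real p) * exponent_moment 1 p k * divisor_moment 0 m" by simp
  have "divisor_moment 2 (p ^ k * m)
     = (\<Sum>i\<le>k. \<Sum>e | e dvd m. (real i ^ 0 * q ^ i) * (ln (real e) ^ 2 / real e)
          + 2 * ln (real p) * ((real i ^ 1 * q ^ i) * (ln (real e) ^ 1 / real e))
          + ln (real p) ^ 2 * ((real i ^ 2 * q ^ i) * (ln (real e) ^ 0 / real e)))"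
    unfolding dm by (intro sum.cong refl) (simp add: algebra_simps add_divide_distrib power2_eq_square)
  also have "\<dots> = exponent_moment 0 p k * divisor_moment 2 m
           + 2 * ln (real p) * (exponent_moment 1 p k * divisor_moment 1 m)
           + ln (real p) ^ 2 * (exponent_moment 2 p k * divisor_moment 0 m)"
    by (simp only: sum.distrib sum_distrib_left[symmetric] sum_distrib_right[symmetric]
          exponent_moment_def divisor_moment_def q_def)
  finally show "divisor_moment 2 (p ^ k * m) = exponent_moment 0 p k * divisor_moment 2 m
           + 2 * ln (real p) * exponent_moment 1 p k * divisor_moment 1 m
           + ln (real p) ^ 2 * exponent_moment 2 p k * divisor_moment 0 m" by simp
qed

text \<open>The expected exponent of \<open>p\<close> in a divisor of \<open>p ^ k\<close> that is drawn with weight \<open>1 / d\<close>.\<close>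

definition mean_exponent :: "nat \<Rightarrow> nat \<Rightarrow> real" where
  "mean_exponent p k = exponent_moment 1 p k / exponent_moment 0 p k"

text \<open>Additivity of expectation. This is an exact identity, so it serves both bounds.\<close>

lemma divisor_moment_1_prod:
  assumes "finite A" "\<And>p. p \<in> A \<Longrightarrow> prime p"
  shows "divisor_moment 1 (\<Prod>p\<in>A. p ^ k p)
    = divisor_moment 0 (\<Prod>p\<in>A. p ^ k p) * (\<Sum>p\<in>A. ln (real p) * mean_exponent p (k p))"
  using assms
proof (induction A rule: finite_induct)
  case empty
  then show ?case by (simp add: divisor_moment_def)
next
  case (insert p A)
  let ?m = "\<Prod>p\<in>A. p ^ k p"
  have p: "prime p" using insert by auto
  have nd: "\<not> p dvd ?m" using insert by (intro not_dvd_prod_prime_powers) auto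
  have g: "exponent_moment 0 p (k p) > 0" using exponent_moment_0_ge1[of p "k p"] by linarith
  show ?case using insert g
    by (simp add: divisor_moment_prime_power_mult[OF p nd] mean_exponent_def field_simps
             del: One_nat_def)
qed

text \<open>For independent variables, the second moment of a sum is the square of the mean plus the
variances. The variances are estimated by second moments, which costs the term \<open>e\<^sup>2\<close> that the
last inequality drops.\<close>

lemma divisor_moment_2_prod_le:
  assumes "finite A" "\<And>p. p \<in> A \<Longrightarrow> prime p"
  shows "divisor_moment 2 (\<Prod>p\<in>A. p ^ k p)
    \<le> divisor_moment 0 (\<Prod>p\<in>A. p ^ k p) * ((\<Sum>p\<in>A. ln (real p) * mean_exponent p (k p))\<^sup>2
        + (\<Sum>p\<in>A. ln (real p) ^ 2 * (exponent_moment 2 p (k p) / exponent_moment 0 p (k p))))"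
  using assms
proof (induction A rule: finite_induct)
  case empty
  then show ?case by (simp add: divisor_moment_def)
next
  case (insert p A)
  let ?m = "\<Prod>p\<in>A. p ^ k p"
  let ?E = "\<Sum>p\<in>A. ln (real p) * mean_exponent p (k p)"
  let ?F = "\<Sum>p\<in>A. ln (real p) ^ 2 * (exponent_moment 2 p (k p) / exponent_moment 0 p (k p))"
  let ?e = "ln (real p) * mean_exponent p (k p)"
  let ?f = "ln (real p) ^ 2 * (exponent_moment 2 p (k p) / exponent_moment 0 p (k p))"
  let ?g = "exponent_moment 0 p (k p)"
  have p: "prime p" using insert by auto
  have nd: "\<not> p dvd ?m" using insert by (intro not_dvd_prod_prime_powers) auto
  have g: "?g > 0" using exponent_moment_0_ge1[of p "k p"] by linarith
  have m0: "divisor_moment 0 ?m \<ge> 0" by (simp add: divisor_moment_def sum_nonneg)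
  have IH: "divisor_moment 2 ?m \<le> divisor_moment 0 ?m * (?E\<^sup>2 + ?F)" using insert by auto
  have m1: "divisor_moment 1 ?m = divisor_moment 0 ?m * ?E"
    using insert by (intro divisor_moment_1_prod) auto
  have "divisor_moment 2 (p ^ k p * ?m) = ?g * (divisor_moment 2 ?m + 2 * ?e * divisor_moment 1 ?m + ?f * divisor_moment 0 ?m)"
    using g by (simp add: divisor_moment_prime_power_mult[OF p nd] mean_exponent_def field_simps
                     del: One_nat_def)
  also have "\<dots> \<le> ?g * (divisor_moment 0 ?m * (?E\<^sup>2 + ?F) + 2 * ?e * (divisor_moment 0 ?m * ?E) + ?f * divisor_moment 0 ?m)"
    using IH g m1 by (intro mult_left_mono) auto
  also have "\<dots> = ?g * divisor_moment 0 ?m * ((?e + ?E)\<^sup>2 - ?e\<^sup>2 + (?f + ?F))"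
    by (simp add: algebra_simps power2_eq_square)
  also have "\<dots> \<le> ?g * divisor_moment 0 ?m * ((?e + ?E)\<^sup>2 + (?f + ?F))"
    using g m0 by (intro mult_left_mono) auto
  finally show ?case using insert
    by (simp add: divisor_moment_prime_power_mult[OF p nd])
qed

lemma exponent_moment_0_le:
  assumes "prime p"
  shows "exponent_moment 0 p k \<le> 1 / (1 - 1 / real p)"
proof -
  have p: "real p \<ge> 2" using assms prime_ge_2_nat by auto
  let ?q = "1 / real p"
  have "(1 - ?q) * (\<Sum>i\<le>k. ?q ^ i) = 1 - ?q ^ Suc k"
    by (rule sum_gp_basic)
  also have "\<dots> \<le> 1" by simp
  finally have "(\<Sum>i\<le>k. ?q ^ i) \<le> 1 / (1 - ?q)" using p by (simp add: field_simps)
  thus ?thesis by (simp add: exponent_moment_def)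
qed

text \<open>Multiplying the first moment by \<open>p - 1\<close> telescopes it into the zeroth moment, with a
nonpositive boundary term. So the truncation at \<open>k\<close> can only lower the mean \<open>1 / (p - 1)\<close> of the
full geometric distribution.\<close>

lemma mean_exponent_le:
  assumes "prime p"
  shows "mean_exponent p k \<le> 1 / (real p - 1)"
proof -
  have p: "real p \<ge> 2" using assms prime_ge_2_nat by auto
  have "(real p - 1) * exponent_moment 1 p k = exponent_moment 0 p k - (1 + real k) * (1 / real p) ^ k"
  proof (induction k)
    case 0
    then show ?case by (simp add: exponent_moment_def)
  next
    case (Suc k)
    define y where "y = (1 / real p) ^ Suc k"
    have x: "(1 / real p) ^ k = real p * y" using p by (simp add: y_def)
    have step: "exponent_moment j p (Suc k) = exponent_moment j p k + (real k + 1) ^ j * y" for j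
      by (simp add: exponent_moment_def y_def add.commute)
    show ?case using Suc
      unfolding step x y_def[symmetric] by (simp add: algebra_simps)
  qed
  hence "(real p - 1) * exponent_moment 1 p k \<le> exponent_moment 0 p k" by simp
  thus ?thesis using p exponent_moment_0_ge1[of p k]
    by (simp add: mean_exponent_def field_simps)
qed

lemma mean_exponent_ge:
  assumes "prime p" "k \<ge> 1"
  shows "mean_exponent p k \<ge> 1 / real p - 1 / real p ^ 2"
proof -
  have p: "real p \<ge> 2" using assms prime_ge_2_nat by auto
  have "(\<Sum>i\<in>{1}. real i ^ 1 * (1 / real p) ^ i) \<le> (\<Sum>i\<le>k. real i ^ 1 * (1 / real p) ^ i)"
    using assms by (intro sum_mono2) auto
  hence 1: "1 / real p \<le> exponent_moment 1 p k" by (simp add: exponent_moment_def)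
  have "1 / real p - 1 / real p ^ 2 = (1 / real p) / (1 / (1 - 1 / real p))"
    using p by (simp add: field_simps power2_eq_square)
  also have "\<dots> \<le> exponent_moment 1 p k / exponent_moment 0 p k"
    using 1 exponent_moment_0_le[OF assms(1), of k] exponent_moment_0_ge1[of p k]
    by (intro frac_le) (auto intro: order.trans[rotated] simp del: One_nat_def)
  finally show ?thesis by (simp add: mean_exponent_def)
qed

text \<open>The same telescoping turns \<open>(p - 1)\<close> times the second moment into the sum of \<open>(2 * i + 1) / p ^ i\<close>,
that is, twice the first moment plus the zeroth, minus a boundary term.\<close>

lemma exponent_moment_2_le:
  assumes "prime p"
  shows "exponent_moment 2 p k / exponent_moment 0 p k \<le> 6 / real p"
proof -
  have p: "real p \<ge> 2" using assms prime_ge_2_nat by auto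
  let ?g0 = "exponent_moment 0 p k"
  have g0: "?g0 \<ge> 1" by (rule exponent_moment_0_ge1)
  have eq: "(real p - 1) * exponent_moment 2 p k
     = 2 * exponent_moment 1 p k + ?g0 - (1 + real k) ^ 2 * (1 / real p) ^ k"
  proof (induction k)
    case 0
    then show ?case by (simp add: exponent_moment_def)
  next
    case (Suc k)
    define y where "y = (1 / real p) ^ Suc k"
    have x: "(1 / real p) ^ k = real p * y" using p by (simp add: y_def)
    have step: "exponent_moment j p (Suc k) = exponent_moment j p k + (real k + 1) ^ j * y" for j
      by (simp add: exponent_moment_def y_def add.commute)
    show ?case using Suc
      unfolding step x y_def[symmetric] by (simp add: algebra_simps power2_eq_square)
  qed
  have "exponent_moment 1 p k \<le> 1 / (real p - 1) * ?g0"
    using mean_exponent_le[OF assms, of k] g0 by (simp add: mean_exponent_def divide_le_eq)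
  also have "\<dots> \<le> 1 * ?g0" using p g0 by (intro mult_right_mono) auto
  finally have "(real p - 1) * exponent_moment 2 p k \<le> 3 * ?g0"
    unfolding eq by (smt (verit) zero_le_mult_iff zero_le_power2 zero_le_power zero_le_divide_1_iff of_nat_0_le_iff)
  moreover have "real p / 2 * exponent_moment 2 p k \<le> (real p - 1) * exponent_moment 2 p k"
    using p by (intro mult_right_mono) (auto simp: exponent_moment_def intro!: sum_nonneg)
  ultimately have "real p * exponent_moment 2 p k \<le> 6 * ?g0" by linarith
  thus ?thesis using p g0 by (simp add: field_simps)
qed

section \<open>Prime sums up to powers of two\<close>

lemma ln2_ge_half: "ln 2 \<ge> (1/2::real)"
  using ln_le_minus_one[of "1/2::real"] by (simp add: ln_div)

definition primes_le :: "nat \<Rightarrow> nat set" where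
  "primes_le N = {p. prime p \<and> p \<le> N}"

lemma finite_primes_le [simp]: "finite (primes_le N)"
  by (rule finite_subset[of _ "{..N}"]) (auto simp: primes_le_def)

lemma primes_leD: "p \<in> primes_le N \<Longrightarrow> prime p \<and> p \<le> N \<and> 2 \<le> p"
  by (auto simp: primes_le_def prime_ge_2_nat)

definition dyadic_primes :: "nat \<Rightarrow> nat set" where
  "dyadic_primes j = primes_le (2 ^ Suc j) - primes_le (2 ^ j)"

lemma finite_dyadic_primes [simp]: "finite (dyadic_primes j)"
  by (simp add: dyadic_primes_def)

lemma dyadic_primesD: "p \<in> dyadic_primes j \<Longrightarrow> prime p \<and> 2 ^ j < p \<and> p \<le> 2 ^ Suc j \<and> 2 \<le> p"
  by (auto simp: dyadic_primes_def primes_le_def prime_ge_2_nat)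

lemma sum_primes_le_Suc:
  fixes f :: "nat \<Rightarrow> real"
  shows "sum f (primes_le (2 ^ Suc j)) = sum f (primes_le (2 ^ j)) + sum f (dyadic_primes j)"
proof -
  have "primes_le (2 ^ j) \<subseteq> primes_le (2 ^ Suc j)" by (auto simp: primes_le_def)
  from sum.subset_diff[OF this finite_primes_le, of f]
  show ?thesis by (simp add: dyadic_primes_def add.commute)
qed

lemma sum_dyadic_primes:
  fixes f :: "nat \<Rightarrow> real"
  shows "(\<Sum>j<n. sum f (dyadic_primes j)) = sum f (primes_le (2 ^ n))"
proof (induction n)
  case 0
  have "primes_le 1 = {}" by (auto dest: primes_leD)
  then show ?case by simp
next
  case (Suc n)
  then show ?case by (simp only: sum_primes_le_Suc sum.lessThan_Suc)
qed

lemma ln_nat_le_powr: "ln (real n) \<le> 2 * real n powr (1/2)"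
  by (cases "n = 0") (use ln_powr_bound[of "real n" "1/2"] in auto)

text \<open>Uniform in \<open>A\<close>, so that it can absorb every error that is quadratic in \<open>1 / p\<close>.\<close>

lemma sum_ln_over_square_bounded:
  "\<exists>K. \<forall>A. finite A \<longrightarrow> (\<Sum>p\<in>A. ln (real p) / real p ^ 2) \<le> K"
proof -
  have "summable (\<lambda>n. real n powr (-3/2))" by (simp add: summable_real_powr_iff)
  hence s: "summable (\<lambda>n. 2 * real n powr (-3/2))" by (intro summable_mult)
  have "(\<Sum>p\<in>A. ln (real p) / real p ^ 2) \<le> (\<Sum>n. 2 * real n powr (-3/2))" if "finite A" for A
  proof -
    have "(\<Sum>p\<in>A. ln (real p) / real p ^ 2) \<le> (\<Sum>p\<in>A. 2 * real p powr (-3/2))"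
    proof (rule sum_mono)
      fix p :: nat
      show "ln (real p) / real p ^ 2 \<le> 2 * real p powr (-3/2)"
      proof (cases "p = 0")
        case False
        have "2 * real p powr (1/2) / real p ^ 2 = 2 * (real p powr (1/2) * real p powr (-2))"
          using False by (simp add: powr_minus powr_numeral field_simps)
        also have "\<dots> = 2 * real p powr (-3/2)" by (simp flip: powr_add)
        finally show ?thesis
          using divide_right_mono[OF ln_nat_le_powr[of p], of "real p ^ 2"] by simp
      qed simp
    qed
    also have "\<dots> \<le> (\<Sum>n. 2 * real n powr (-3/2))"
      by (rule sum_le_suminf[OF s that]) auto
    finally show ?thesis .
  qed
  thus ?thesis by blast
qed

lemma prod_primes_dvd:
  fixes n :: nat
  assumes "finite A" "\<And>p. p \<in> A \<Longrightarrow> prime p \<and> p dvd n"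
  shows "\<Prod>A dvd n"
  using assms
proof (induction A rule: finite_induct)
  case (insert p A)
  have "coprime p (\<Prod>A)"
    using insert by (intro prod_coprime_right primes_coprime) auto
  thus ?case using insert by (auto intro: divides_mult)
qed simp

text \<open>The primes of the block all divide the central binomial coefficient of \<open>2\<^sup>j * 2\<close> over \<open>2\<^sup>j\<close>: they
occur in the numerator, and they are too large for the denominator.\<close>

lemma chebyshev_theta_dyadic_step:
  "(\<Sum>p\<in>dyadic_primes j. ln (real p)) \<le> 2 ^ Suc j * ln 2"
proof -
  let ?N = "(2::nat) ^ j"
  let ?B = "(2 * ?N) choose ?N"
  have Bpos: "?B > 0" by simp
  have "(\<Prod>p\<in>dyadic_primes j. p) dvd ?B"
  proof (rule prod_primes_dvd)
    fix p assume p: "p \<in> dyadic_primes j"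
    note D = dyadic_primesD[OF p]
    have "fact (2 * ?N) = fact ?N * fact ?N * ?B"
      using binomial_fact_lemma[of ?N "2 * ?N"] by simp
    moreover have "p dvd fact (2 * ?N)" using D by (simp add: prime_dvd_fact_iff)
    moreover have "\<not> p dvd fact ?N" using D by (simp add: prime_dvd_fact_iff)
    ultimately show "prime p \<and> p dvd ?B" using D by (metis prime_dvd_mult_iff)
  qed simp
  hence "(\<Prod>p\<in>dyadic_primes j. p) \<le> ?B" using Bpos by (rule dvd_imp_le)
  also have "\<dots> \<le> 2 ^ (2 * ?N)" by (rule binomial_le_pow2)
  finally have "real (\<Prod>p\<in>dyadic_primes j. p) \<le> real (2 ^ (2 * ?N))" by (simp only: of_nat_le_iff)
  moreover have pos: "\<forall>p\<in>dyadic_primes j. real p > 0" by (auto dest!: dyadic_primesD)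
  moreover have "real (\<Prod>p\<in>dyadic_primes j. p) > 0"
    using pos by (simp add: prod_pos)
  ultimately have "ln (real (\<Prod>p\<in>dyadic_primes j. p)) \<le> ln (real (2 ^ (2 * ?N)))"
    by (subst ln_le_cancel_iff) auto
  also have "\<dots> = 2 ^ Suc j * ln 2" by (simp add: ln_realpow)
  also have "ln (real (\<Prod>p\<in>dyadic_primes j. p)) = (\<Sum>p\<in>dyadic_primes j. ln (real p))"
    using pos by (simp add: ln_prod)
  finally show ?thesis .
qed

lemma chebyshev_theta_le:
  "(\<Sum>p\<in>primes_le (2 ^ n). ln (real p)) \<le> 2 ^ Suc n * ln 2"
proof -
  have "(\<Sum>p\<in>primes_le (2 ^ n). ln (real p)) \<le> (\<Sum>j<n. 2 ^ Suc j * ln 2)"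
    unfolding sum_dyadic_primes[symmetric] by (intro sum_mono chebyshev_theta_dyadic_step)
  also have "\<dots> = (2 ^ Suc n - 2) * ln 2" by (induction n) (simp_all add: algebra_simps)
  also have "\<dots> \<le> 2 ^ Suc n * ln 2" by (intro mult_right_mono) auto
  finally show ?thesis .
qed

text \<open>Expand \<open>ln m\<close> as the sum of the Mangoldt function over the divisors of \<open>m\<close>, and count for each \<open>d\<close>
its multiples up to \<open>N\<close>.\<close>

lemma ln_fact_eq_sum_mangoldt:
  "ln (fact N :: real) = (\<Sum>d\<in>{1..N}. mangoldt d * real (N div d))"
proof -
  have "ln (fact N :: real) = (\<Sum>m\<in>{1..N}. ln (real m))"
    by (induction N) (simp_all add: ln_mult del: of_nat_Suc)
  also have "\<dots> = (\<Sum>m\<in>{1..N}. \<Sum>d | d dvd m. mangoldt d)"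
    by (intro sum.cong refl) (simp add: mangoldt_sum)
  also have "\<dots> = (\<Sum>m\<in>{1..N}. \<Sum>d\<in>{1..N}. if d dvd m then mangoldt d else 0)"
  proof (rule sum.cong[OF refl])
    fix m assume m: "m \<in> {1..N}"
    have div: "{d. d dvd m} = {d\<in>{1..N}. d dvd m}"
      using m by (auto dest: dvd_imp_le intro!: Suc_leI Nat.gr0I)
    show "(\<Sum>d | d dvd m. mangoldt d) = (\<Sum>d\<in>{1..N}. if d dvd m then mangoldt d else (0::real))"
      unfolding div by (rule sum.inter_filter) simp
  qed
  also have "\<dots> = (\<Sum>d\<in>{1..N}. \<Sum>m\<in>{1..N}. if d dvd m then mangoldt d else 0)"
    by (rule sum.swap)
  also have "\<dots> = (\<Sum>d\<in>{1..N}. mangoldt d * real (N div d))"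
  proof (rule sum.cong[OF refl])
    fix d assume d: "d \<in> {1..N}"
    have "{m\<in>{1..N}. d dvd m} = (\<lambda>k. d * k) ` {1..N div d}"
    proof (intro equalityI subsetI)
      fix m assume "m \<in> {m\<in>{1..N}. d dvd m}"
      then obtain k where "m = d * k" "m \<le> N" "m \<ge> 1" by auto
      thus "m \<in> (\<lambda>k. d * k) ` {1..N div d}"
        using d by (auto simp: less_eq_div_iff_mult_less_eq mult.commute intro!: imageI Suc_leI Nat.gr0I)
    next
      fix m assume "m \<in> (\<lambda>k. d * k) ` {1..N div d}"
      thus "m \<in> {m\<in>{1..N}. d dvd m}"
        using d by (auto simp: less_eq_div_iff_mult_less_eq mult.commute intro!: Suc_leI)
    qed
    hence "card {m\<in>{1..N}. d dvd m} = N div d"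
      using d by (simp add: card_image inj_on_def)
    thus "(\<Sum>m\<in>{1..N}. if d dvd m then mangoldt d else 0) = mangoldt d * real (N div d)"
      by (simp add: sum.inter_filter[symmetric] mult.commute)
  qed
  finally show ?thesis .
qed

lemma ln_fact_le: "ln (fact N :: real) \<le> real N * ln (real N)"
proof (cases "N = 0")
  case False
  have "(fact N :: real) \<le> real N ^ N" using fact_le_power[of N, where 'a = real] by simp
  hence "ln (fact N :: real) \<le> ln (real N ^ N)" using False by (subst ln_le_cancel_iff) auto
  thus ?thesis using False by (simp add: ln_realpow)
qed simp

lemma ln_fact_ge: "ln (fact N :: real) \<ge> real N * ln (real N) - real N"
proof (induction N)
  case (Suc N)
  show ?case
  proof (cases "N = 0")
    case False
    have "ln (1 + 1 / real N) \<le> 1 / real N" using False by (intro ln_add_one_self_le_self) auto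
    moreover have "ln (real (Suc N)) = ln (real N) + ln (1 + 1 / real N)"
    proof -
      have "real (Suc N) = real N * (1 + 1 / real N)" using False by (simp add: field_simps)
      thus ?thesis using False by (simp only: ln_mult)
        (simp add: add_nonneg_eq_0_iff)
    qed
    ultimately have "ln (real (Suc N)) \<le> ln (real N) + 1 / real N" by linarith
    hence "real N * ln (real (Suc N)) \<le> real N * (ln (real N) + 1 / real N)"
      by (intro mult_left_mono) auto
    hence "real N * ln (real (Suc N)) \<le> real N * ln (real N) + 1"
      using False by (simp add: algebra_simps)
    moreover have "ln (fact (Suc N) :: real) = ln (real (Suc N)) + ln (fact N)"
      by (simp add: ln_mult del: of_nat_Suc)
    ultimately show ?thesis using Suc by (simp add: algebra_simps)
  qed simp
qed simp

text \<open>In the expansion of \<open>ln (N!)\<close> keep only the primes and replace \<open>N div p\<close> by \<open>N / p - 1\<close>. The loss is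
Chebyshev's function, which is \<open>O(N)\<close>.\<close>

lemma sum_prime_ln_over_le:
  "(\<Sum>p\<in>primes_le (2 ^ n). ln (real p) / real p) \<le> real n * ln 2 + 2 * ln 2"
proof -
  let ?N = "(2::nat) ^ n"
  have "(\<Sum>p\<in>primes_le ?N. ln (real p) * (real ?N / real p - 1)) \<le> (\<Sum>p\<in>primes_le ?N. ln (real p) * real (?N div p))"
  proof (intro sum_mono mult_left_mono)
    fix p assume "p \<in> primes_le ?N"
    thus "0 \<le> ln (real p)" by (auto dest!: primes_leD)
    show "real ?N / real p - 1 \<le> real (?N div p)"
      using real_of_int_div3[of "int ?N" "int p"] unfolding zdiv_int[symmetric] of_int_of_nat_eq by linarith
  qed
  also have "\<dots> = (\<Sum>p\<in>primes_le ?N. mangoldt p * real (?N div p))"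
    by (intro sum.cong refl) (auto simp: primes_le_def)
  also have "\<dots> \<le> (\<Sum>d\<in>{1..?N}. mangoldt d * real (?N div d))"
    by (intro sum_mono2) (auto dest: primes_leD intro!: mult_nonneg_nonneg mangoldt_nonneg)
  also have "\<dots> \<le> real ?N * ln (real ?N)"
    unfolding ln_fact_eq_sum_mangoldt[symmetric] by (rule ln_fact_le)
  also have "\<dots> = 2 ^ n * (real n * ln 2)" by (simp add: ln_realpow)
  finally have "(\<Sum>p\<in>primes_le ?N. ln (real p) * (real ?N / real p - 1)) \<le> 2 ^ n * (real n * ln 2)" .
  moreover have "(\<Sum>p\<in>primes_le ?N. ln (real p) * (real ?N / real p - 1))
      = 2 ^ n * (\<Sum>p\<in>primes_le ?N. ln (real p) / real p) - (\<Sum>p\<in>primes_le ?N. ln (real p))"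
    by (simp add: sum_distrib_left sum_subtractf right_diff_distrib mult_ac)
  ultimately have "2 ^ n * (\<Sum>p\<in>primes_le ?N. ln (real p) / real p) \<le> 2 ^ n * (real n * ln 2 + 2 * ln 2)"
    using chebyshev_theta_le[of n] by (simp add: algebra_simps)
  thus ?thesis by simp
qed

text \<open>For a fixed prime, the powers contribute a geometric series with sum \<open>1 / (p - 1)\<close>.\<close>

lemma sum_mangoldt_over_le:
  "(\<Sum>d\<in>{1..N}. mangoldt d / real d) \<le> (\<Sum>p\<in>primes_le N. ln (real p) / (real p - 1))"
proof -
  have "(\<Sum>d\<in>{1..N}. mangoldt d / real d) = (\<Sum>d\<in>{d\<in>{1..N}. primepow d}. mangoldt d / real d)"
    by (intro sum.mono_neutral_right) (auto simp: mangoldt_def)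
  also have "\<dots> \<le> (\<Sum>d\<in>(\<lambda>(p,k). p ^ k) ` (primes_le N \<times> {1..N}). mangoldt d / real d)"
  proof (intro sum_mono2)
    show "{d \<in> {1..N}. primepow d} \<subseteq> (\<lambda>(p, k). p ^ k) ` (primes_le N \<times> {1..N})"
    proof
      fix d assume d: "d \<in> {d \<in> {1..N}. primepow d}"
      then obtain p k where pk: "prime p" "k > 0" "d = p ^ k" by (auto simp: primepow_def)
      have "p \<le> p ^ k" using pk prime_ge_1_nat by (intro self_le_power) auto
      moreover have "k < p ^ k" using pk prime_gt_1_nat by (intro power_gt_expt) auto
      ultimately show "d \<in> (\<lambda>(p, k). p ^ k) ` (primes_le N \<times> {1..N})"
        using d pk by (auto simp: primes_le_def intro!: image_eqI[of _ _ "(p, k)"])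
    qed
  qed (auto intro!: divide_nonneg_nonneg mangoldt_nonneg)
  also have "\<dots> \<le> (\<Sum>(p,k)\<in>primes_le N \<times> {1..N}. mangoldt (p ^ k) / real (p ^ k))"
  proof -
    have "sum (\<lambda>d. mangoldt d / real d) ((\<lambda>(p,k). p ^ k) ` (primes_le N \<times> {1..N}))
        \<le> sum ((\<lambda>d. mangoldt d / real d) \<circ> (\<lambda>(p,k). p ^ k)) (primes_le N \<times> {1..N})"
      by (intro sum_image_le) (auto intro!: divide_nonneg_nonneg mangoldt_nonneg)
    thus ?thesis by (simp add: o_def case_prod_unfold)
  qed
  also have "\<dots> = (\<Sum>p\<in>primes_le N. \<Sum>k\<in>{1..N}. mangoldt (p ^ k) / real (p ^ k))"
    by (rule sum.cartesian_product[symmetric])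
  also have "\<dots> \<le> (\<Sum>p\<in>primes_le N. ln (real p) / (real p - 1))"
  proof (rule sum_mono)
    fix p assume "p \<in> primes_le N"
    hence p: "prime p" "p \<ge> 2" by (auto dest: primes_leD)
    have gp: "(\<Sum>k\<in>{1..N}. 1 / real p ^ k) = (1 - 1 / real p ^ N) / (real p - 1)"
    proof (induction N)
      case (Suc N)
      then show ?case using p by (simp add: divide_simps) (simp add: algebra_simps)
    qed simp
    have "(\<Sum>k\<in>{1..N}. mangoldt (p ^ k) / real (p ^ k)) = ln (real p) * (\<Sum>k\<in>{1..N}. 1 / real p ^ k)"
      unfolding sum_distrib_left using p by (intro sum.cong refl) (simp add: mangoldt_primepow)
    also have "\<dots> \<le> ln (real p) * (1 / (real p - 1))"
      unfolding gp using p by (intro mult_left_mono divide_right_mono) auto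
    finally show "(\<Sum>k\<in>{1..N}. mangoldt (p ^ k) / real (p ^ k)) \<le> ln (real p) / (real p - 1)" by simp
  qed
  finally show ?thesis .
qed

lemma ln_over_pred_le:
  assumes "p \<ge> 2"
  shows "ln (real p) / (real p - 1) \<le> ln (real p) / real p + 2 * (ln (real p) / real p ^ 2)"
proof -
  have "1 / (real p - 1) \<le> 1 / real p + 2 / real p ^ 2"
  proof -
    have "1 / real p + 2 / real p ^ 2 - 1 / (real p - 1) = (real p - 2) / (real p ^ 2 * (real p - 1))"
      using assms by (simp add: field_simps power2_eq_square)
    also have "\<dots> \<ge> 0" using assms by simp
    finally show ?thesis by simp
  qed
  from mult_left_mono[OF this, of "ln (real p)"] show ?thesis
    using assms by (simp add: algebra_simps)
qed

lemma sum_prime_ln_over_pred_ge: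
  "(\<Sum>p\<in>primes_le N. ln (real p) / (real p - 1)) \<ge> ln (real N) - 1"
proof (cases "N = 0")
  case False
  have "real N * (ln (real N) - 1) \<le> ln (fact N)" using ln_fact_ge[of N] by (simp add: algebra_simps)
  also have "\<dots> \<le> (\<Sum>d\<in>{1..N}. mangoldt d * (real N / real d))"
    unfolding ln_fact_eq_sum_mangoldt
    by (intro sum_mono mult_left_mono mangoldt_nonneg of_nat_div_le_of_nat)
  also have "\<dots> = real N * (\<Sum>d\<in>{1..N}. mangoldt d / real d)"
    by (simp add: sum_distrib_left mult_ac)
  also have "\<dots> \<le> real N * (\<Sum>p\<in>primes_le N. ln (real p) / (real p - 1))"
    by (intro mult_left_mono sum_mangoldt_over_le) auto
  finally show ?thesis using False by simp
next
  case True
  then show ?thesis by (auto simp: primes_le_def)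
qed

theorem mertens_first_dyadic:
  "\<exists>C. \<forall>n. \<bar>(\<Sum>p\<in>primes_le (2 ^ n). ln (real p) / real p) - real n * ln 2\<bar> \<le> C"
proof -
  obtain K where K: "\<And>A. finite A \<Longrightarrow> (\<Sum>p\<in>A. ln (real p) / real p ^ 2) \<le> K"
    using sum_ln_over_square_bounded by blast
  have "K \<ge> 0" using K[of "{}"] by simp
  have "\<bar>(\<Sum>p\<in>primes_le (2 ^ n). ln (real p) / real p) - real n * ln 2\<bar> \<le> 2 * K + 2" for n
  proof -
    let ?A = "\<Sum>p\<in>primes_le (2 ^ n). ln (real p) / real p"
    have "real n * ln 2 - 1 = ln (real (2 ^ n)) - 1" by (simp add: ln_realpow)
    also have "\<dots> \<le> (\<Sum>p\<in>primes_le (2 ^ n). ln (real p) / (real p - 1))"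
      by (rule sum_prime_ln_over_pred_ge)
    also have "\<dots> \<le> (\<Sum>p\<in>primes_le (2 ^ n). ln (real p) / real p + 2 * (ln (real p) / real p ^ 2))"
      by (intro sum_mono ln_over_pred_le) (auto dest: primes_leD)
    also have "\<dots> = ?A + 2 * (\<Sum>p\<in>primes_le (2 ^ n). ln (real p) / real p ^ 2)"
      by (simp add: sum.distrib sum_distrib_left)
    also have "\<dots> \<le> ?A + 2 * K" using K[of "primes_le (2 ^ n)"] by simp
    finally have "real n * ln 2 - 1 \<le> ?A + 2 * K" .
    moreover have "?A \<le> real n * ln 2 + 2 * ln 2" by (rule sum_prime_ln_over_le)
    moreover have "ln 2 \<le> (1::real)" using ln_le_minus_one[of "2::real"] by simp
    ultimately show ?thesis using \<open>K \<ge> 0\<close> by (simp add: abs_le_iff)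
  qed
  thus ?thesis by blast
qed

section \<open>Summation lemmas and finite Euler products\<close>

text \<open>The special case of Dirichlet's test with weights \<open>1 / (j + 1)\<close>, by summation by parts.\<close>

lemma summable_over_index:
  fixes e :: "nat \<Rightarrow> real"
  assumes "\<And>n. \<bar>\<Sum>j<n. e j\<bar> \<le> C"
  shows "summable (\<lambda>j. e j / real (Suc j))"
proof -
  define s where "s n = (\<Sum>j<n. e j)" for n
  \<comment> \<open>Summation by parts, with the boundary term at \<open>n + 1\<close> so that it tends to \<open>0\<close>.\<close>
  have parts: "(\<Sum>j<n. e j / real (Suc j))
      = s n / real (Suc n) + (\<Sum>j<n. s (Suc j) * (1 / real (Suc j) - 1 / real (Suc (Suc j))))" for n
  proof (induction n)
    case 0
    then show ?case by (simp add: s_def)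
  next
    case (Suc n)
    have "e n = s (Suc n) - s n" by (simp add: s_def)
    then show ?case using Suc.IH
      by (simp add: diff_divide_distrib right_diff_distrib del: of_nat_Suc)
  qed
  have "(\<lambda>n. inverse (real (Suc n))) \<longlonglongrightarrow> 0" by (rule LIMSEQ_inverse_real_of_nat)
  hence inv: "(\<lambda>n. 1 / real (Suc n)) \<longlonglongrightarrow> 0" by (simp add: inverse_eq_divide)
  have C: "C \<ge> 0" using assms[of 0] by simp
  have "norm (s n / real (Suc n)) \<le> C * (1 / real (Suc n))" for n
    using divide_right_mono[OF assms[of n], of "real (Suc n)"]
    by (simp add: s_def del: of_nat_Suc)
  moreover have "(\<lambda>n. C * (1 / real (Suc n))) \<longlonglongrightarrow> 0"
    using tendsto_mult[OF tendsto_const[of C] inv] by simp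
  ultimately have "(\<lambda>n. s n / real (Suc n)) \<longlonglongrightarrow> 0"
    by (rule Lim_null_comparison[OF always_eventually[OF allI]])
  moreover have "summable (\<lambda>j. s (Suc j) * (1 / real (Suc j) - 1 / real (Suc (Suc j))))"
  proof (rule summable_comparison_test')
    have "summable (\<lambda>j. 1 / real (Suc j) - 1 / real (Suc (Suc j)))"
      by (rule telescope_summable'[OF inv])
    thus "summable (\<lambda>j. C * (1 / real (Suc j) - 1 / real (Suc (Suc j))))" by (rule summable_mult)
    fix j
    have "1 / real (Suc j) - 1 / real (Suc (Suc j)) \<ge> 0" by (simp add: field_simps)
    thus "norm (s (Suc j) * (1 / real (Suc j) - 1 / real (Suc (Suc j))))
        \<le> C * (1 / real (Suc j) - 1 / real (Suc (Suc j)))"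
      using assms[of "Suc j"] unfolding real_norm_def abs_mult s_def
      by (intro mult_mono) (auto simp: C)
  qed
  hence "(\<lambda>n. \<Sum>j<n. s (Suc j) * (1 / real (Suc j) - 1 / real (Suc (Suc j)))) \<longlonglongrightarrow>
      (\<Sum>j. s (Suc j) * (1 / real (Suc j) - 1 / real (Suc (Suc j))))" by (rule summable_LIMSEQ)
  ultimately have "(\<lambda>n. \<Sum>j<n. e j / real (Suc j)) \<longlonglongrightarrow>
     0 + (\<Sum>j. s (Suc j) * (1 / real (Suc j) - 1 / real (Suc (Suc j))))"
    unfolding parts by (rule tendsto_add)
  thus ?thesis unfolding summable_iff_convergent convergent_def by blast
qed

text \<open>Abel's limit theorem. If \<open>t\<^sub>n\<close> is the error of the partial sum up to \<open>n\<close>, then the power series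
differs from \<open>l\<close> by \<open>(1 - z) * (\<Sum>n. t\<^sub>n * z ^ n)\<close>; the first terms vanish with the factor \<open>1 - z\<close>, and
the rest is small since \<open>t\<^sub>n\<close> is.\<close>

lemma abel_limit:
  fixes c :: "nat \<Rightarrow> real"
  assumes "c sums l"
  shows "((\<lambda>z. \<Sum>j. c j * z ^ j) \<longlongrightarrow> l) (at_left 1)"
proof -
  define t where "t n = (\<Sum>j\<le>n. c j) - l" for n
  have t0: "t \<longlonglongrightarrow> 0"
    using assms unfolding t_def sums_def_le by (simp add: LIM_zero)
  \<comment> \<open>Boundedness of \<open>t\<close> is enough for its power series to converge.\<close>
  have "Bseq t" using t0 convergent_imp_Bseq convergentI by blast
  then obtain B where B: "\<And>n. \<bar>t n\<bar> \<le> B" by (auto simp: Bseq_def)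
  have geo: "summable (\<lambda>n. z ^ n)" if "0 < z" "z < 1" for z :: real
    using that by (intro summable_geometric) auto
  have sumt: "summable (\<lambda>n. \<bar>t n * z ^ n\<bar>)" if z: "0 < z" "z < 1" for z
    by (rule summable_comparison_test'[OF summable_mult[OF geo[OF z], of B]])
       (use B z in \<open>auto simp: abs_mult intro!: mult_right_mono\<close>)
  have eq: "(\<Sum>j. c j * z ^ j) - l = (1 - z) * (\<Sum>n. t n * z ^ n)" if z: "0 < z" "z < 1" for z
  proof -
    have s: "summable (\<lambda>n. t n * z ^ n)" using sumt[OF z] by (rule summable_rabs_cancel)
    have s': "summable (\<lambda>n. t (Suc n) * z ^ Suc n)"
      using s by (subst summable_Suc_iff)
    have "(\<lambda>n. t (Suc n) * z ^ Suc n - z * (t n * z ^ n)) sums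
       ((\<Sum>n. t (Suc n) * z ^ Suc n) - z * (\<Sum>n. t n * z ^ n))"
      using s s' by (intro sums_diff sums_mult summable_sums)
    also have "(\<lambda>n. t (Suc n) * z ^ Suc n - z * (t n * z ^ n)) = (\<lambda>n. c (Suc n) * z ^ Suc n)"
      by (auto simp: t_def algebra_simps)
    finally have "(\<lambda>n. c n * z ^ n) sums
       ((\<Sum>n. t (Suc n) * z ^ Suc n) - z * (\<Sum>n. t n * z ^ n) + c 0 * z ^ 0)"
      by (subst (asm) sums_Suc_iff) simp
    moreover have "(\<Sum>n. t (Suc n) * z ^ Suc n) = (\<Sum>n. t n * z ^ n) - t 0"
      using suminf_split_head[OF s] by simp
    ultimately have "(\<Sum>j. c j * z ^ j) = (\<Sum>n. t n * z ^ n) - t 0 - z * (\<Sum>n. t n * z ^ n) + c 0"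
      by (simp add: sums_iff)
    thus ?thesis by (simp add: t_def algebra_simps)
  qed
  show ?thesis
  proof (rule tendstoI)
    fix e :: real assume e: "e > 0"
    obtain N where N: "\<And>n. n \<ge> N \<Longrightarrow> \<bar>t n\<bar> < e / 2"
      using LIMSEQ_D[OF t0, of "e/2"] e by auto
    define M where "M = (\<Sum>n<N. \<bar>t n\<bar>)"
    have M: "M \<ge> 0" by (simp add: M_def sum_nonneg)
    have "((\<lambda>z. (1 - z) * M) \<longlongrightarrow> (1 - 1) * M) (at_left (1::real))"
      by (intro tendsto_intros)
    hence "\<forall>\<^sub>F z in at_left 1. (1 - z) * M < e / 2" using e by (auto dest: order_tendstoD(2)[of _ _ _ "e/2"])
    moreover have "\<forall>\<^sub>F z in at_left (1::real). z \<in> {0<..<1}"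
      by (rule eventually_at_left_real) simp
    ultimately show "\<forall>\<^sub>F z in at_left 1. dist (\<Sum>j. c j * z ^ j) l < e"
    proof eventually_elim
      case (elim z)
      hence z: "0 < z" "z < 1" by auto
      have "\<bar>\<Sum>n. t n * z ^ n\<bar> \<le> (\<Sum>n. \<bar>t n * z ^ n\<bar>)" by (rule summable_rabs[OF sumt[OF z]])
      also have "\<dots> = (\<Sum>n. \<bar>t (n + N) * z ^ (n + N)\<bar>) + (\<Sum>n<N. \<bar>t n * z ^ n\<bar>)"
        by (rule suminf_split_initial_segment[OF sumt[OF z]])
      also have "(\<Sum>n<N. \<bar>t n * z ^ n\<bar>) \<le> M"
        unfolding M_def by (intro sum_mono) (use z in \<open>auto simp: abs_mult power_le_one intro!: mult_left_le\<close>)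
      also have "(\<Sum>n. \<bar>t (n + N) * z ^ (n + N)\<bar>) \<le> (\<Sum>n. e / 2 * z ^ n)"
      proof (rule suminf_le)
        fix n
        have "\<bar>t (n + N)\<bar> * z ^ (n + N) \<le> e / 2 * z ^ n"
          using N[of "n + N"] z e by (intro mult_mono power_decreasing) auto
        thus "\<bar>t (n + N) * z ^ (n + N)\<bar> \<le> e / 2 * z ^ n" using z by (simp add: abs_mult)
      qed (use sumt[OF z] geo[OF z] in \<open>auto simp: intro!: summable_mult summable_ignore_initial_segment[of "\<lambda>n. \<bar>t n * z ^ n\<bar>" N]\<close>)
      also have "(\<Sum>n. e / 2 * z ^ n) = e / 2 * (1 / (1 - z))"
        using z suminf_mult[OF geo[OF z], of "e / 2"] suminf_geometric[of z] by simp
      finally have *: "\<bar>\<Sum>n. t n * z ^ n\<bar> \<le> e / 2 * (1 / (1 - z)) + M" by simp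
      have "\<bar>(\<Sum>j. c j * z ^ j) - l\<bar> = (1 - z) * \<bar>\<Sum>n. t n * z ^ n\<bar>"
        using eq[OF z] z by (simp add: abs_mult)
      also have "\<dots> \<le> (1 - z) * (e / 2 * (1 / (1 - z)) + M)"
        using z by (intro mult_left_mono *) auto
      also have "\<dots> = e / 2 + (1 - z) * M" using z by (simp add: field_simps)
      also have "\<dots> < e" using elim by simp
      finally show ?case by (simp add: dist_real_def)
    qed
  qed
qed

text \<open>Mean value theorem for \<open>x powr (- d)\<close>; it makes the sums of \<open>m powr (-1 - d)\<close> telescope.\<close>

lemma powr_diff_bounds:
  fixes x d :: real
  assumes "x > 0" "d > 0"
  shows "d * (x + 1) powr (-1 - d) \<le> x powr (-d) - (x + 1) powr (-d)"
    and "x powr (-d) - (x + 1) powr (-d) \<le> d * x powr (-1 - d)"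
proof -
  have "\<exists>z. x < z \<and> z < x + 1 \<and> (x + 1) powr (-d) - x powr (-d) = (x + 1 - x) * (- d * z powr (-1 - d))"
    using assms by (intro MVT2) (auto intro!: derivative_eq_intros simp: minus_diff_commute[of 1 d])
  then obtain z where z: "x < z" "z < x + 1"
     "x powr (-d) - (x + 1) powr (-d) = d * z powr (-1 - d)" by fastforce
  show "d * (x + 1) powr (-1 - d) \<le> x powr (-d) - (x + 1) powr (-d)"
    unfolding z(3) using z assms by (intro mult_left_mono powr_mono2') auto
  show "x powr (-d) - (x + 1) powr (-d) \<le> d * x powr (-1 - d)"
    unfolding z(3) using z assms by (intro mult_left_mono powr_mono2') auto
qed

lemma zeta_partial_sum_le:
  assumes "d > 0"
  shows "(\<Sum>m\<in>{1..N}. real m powr (-1 - d)) \<le> 1 + 1 / d"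
proof -
  have "(\<Sum>m\<in>{1..Suc N}. real m powr (-1 - d)) \<le> 1 + (1 - real (Suc N) powr (-d)) / d" for N
  proof (induction N)
    case (Suc N)
    have "real (Suc (Suc N)) powr (-1 - d) \<le> (real (Suc N) powr (-d) - real (Suc (Suc N)) powr (-d)) / d"
      using powr_diff_bounds(1)[of "real (Suc N)" d] assms by (simp add: field_simps)
    thus ?case using Suc by (simp add: diff_divide_distrib del: of_nat_Suc)
  qed simp
  moreover have "1 + (1 - real (Suc N) powr (-d)) / d \<le> 1 + 1 / d" for N
    using assms by (intro add_left_mono divide_right_mono) auto
  ultimately have "(\<Sum>m\<in>{1..Suc N}. real m powr (-1 - d)) \<le> 1 + 1 / d" for N
    by (meson order.trans)
  moreover have "1 + 1 / d \<ge> 0" using assms by simp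
  ultimately show ?thesis by (cases N) auto
qed

lemma zeta_partial_sum_ge:
  assumes "d > 0"
  shows "(1 - (real N + 1) powr (-d)) / d \<le> (\<Sum>m\<in>{1..N}. real m powr (-1 - d))"
proof (induction N)
  case (Suc N)
  have "(real (Suc N) powr (-d) - (real (Suc N) + 1) powr (-d)) / d \<le> real (Suc N) powr (-1 - d)"
    using powr_diff_bounds(2)[of "real (Suc N)" d] assms by (simp add: field_simps)
  thus ?case using Suc by (simp add: diff_divide_distrib add.commute)
qed simp

lemma euler_factor_less_1:
  assumes "p \<ge> 2" "d > 0"
  shows "real p powr (-1 - d) < 1" "real p powr (-1 - d) > 0"
proof -
  have "real p powr (-1 - d) < real p powr 0" using assms by (intro powr_less_mono) auto
  thus "real p powr (-1 - d) < 1" using assms by simp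
  show "real p powr (-1 - d) > 0" using assms by simp
qed

text \<open>Truncating each factor at exponent \<open>K\<close> leaves a sum over the divisors of a single number, hence a
part of \<open>\<zeta>(1 + d)\<close>. Then let \<open>K\<close> tend to infinity. Working with finite sums avoids the function
\<open>\<zeta>\<close> itself.\<close>

lemma euler_product_le:
  assumes "d > 0"
  shows "(\<Prod>p\<in>primes_le N. 1 / (1 - real p powr (-1 - d))) \<le> 1 + 1 / d"
proof (rule LIMSEQ_le_const2)
  show "(\<lambda>K. \<Prod>p\<in>primes_le N. \<Sum>i\<le>K. (real p powr (-1 - d)) ^ i) \<longlonglongrightarrow>
      (\<Prod>p\<in>primes_le N. 1 / (1 - real p powr (-1 - d)))"
  proof (rule tendsto_prod)
    fix p assume "p \<in> primes_le N"
    hence "(\<lambda>i. (real p powr (-1 - d)) ^ i) sums (1 / (1 - real p powr (-1 - d)))"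
      using euler_factor_less_1[of p d] assms by (intro geometric_sums) (auto dest!: primes_leD)
    thus "(\<lambda>K. \<Sum>i\<le>K. (real p powr (-1 - d)) ^ i) \<longlonglongrightarrow> 1 / (1 - real p powr (-1 - d))"
      by (simp add: sums_def_le)
  qed
  have "(\<Prod>p\<in>primes_le N. \<Sum>i\<le>K. (real p powr (-1 - d)) ^ i) \<le> 1 + 1 / d" for K
  proof -
    let ?M = "\<Prod>p\<in>primes_le N. p ^ K"
    have M: "?M > 0" by (intro prod_pos ballI) (auto dest!: primes_leD)
    have "(\<Prod>p\<in>primes_le N. \<Sum>i\<le>K. (real p powr (-1 - d)) ^ i) = (\<Sum>m | m dvd ?M. real m powr (-1 - d))"
      by (rule euler_product_divisors[symmetric]) (auto dest: primes_leD)
    also have "\<dots> \<le> (\<Sum>m\<in>{1..?M}. real m powr (-1 - d))"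
      by (intro sum_mono2) (auto intro!: dvd_imp_le[OF _ M] Suc_leI dvd_pos_nat[OF M])
    also have "\<dots> \<le> 1 + 1 / d" by (rule zeta_partial_sum_le[OF assms])
    finally show ?thesis .
  qed
  thus "\<exists>M. \<forall>K\<ge>M. (\<Prod>p\<in>primes_le N. \<Sum>i\<le>K. (real p powr (-1 - d)) ^ i) \<le> 1 + 1 / d" by blast
qed

lemma dvd_prod_primes_le:
  assumes "m \<in> {1..N}"
  shows "m dvd (\<Prod>p\<in>primes_le N. p ^ N)"
proof -
  have "m = (\<Prod>p\<in>prime_factors m. p ^ multiplicity p m)"
    using assms by (intro prime_factorization_nat) auto
  also have "\<dots> dvd (\<Prod>p\<in>prime_factors m. p ^ N)"
  proof (intro prod_dvd_prod le_imp_power_dvd)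
    fix p assume p: "p \<in> prime_factors m"
    have "1 < p" using p by (intro prime_gt_1_nat) auto
    hence "multiplicity p m < p ^ multiplicity p m" by (intro power_gt_expt) simp
    also have "\<dots> \<le> m" using assms by (intro dvd_imp_le multiplicity_dvd) auto
    finally show "multiplicity p m \<le> N" using assms by auto
  qed
  also have "\<dots> dvd (\<Prod>p\<in>primes_le N. p ^ N)"
    using assms by (intro prod_dvd_prod_subset) (auto simp: primes_le_def dest!: dvd_imp_le)
  finally show ?thesis .
qed

text \<open>All \<open>m \<le> N\<close> divide the product of \<open>p ^ N\<close>, because no prime can occur in \<open>m\<close> with an exponent
above \<open>N\<close>.\<close>

lemma euler_product_ge:
  assumes "d > 0"
  shows "(1 - (real N + 1) powr (-d)) / d \<le> (\<Prod>p\<in>primes_le N. 1 / (1 - real p powr (-1 - d)))"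
proof -
  let ?M = "\<Prod>p\<in>primes_le N. p ^ N"
  have M: "?M > 0" by (intro prod_pos ballI) (auto dest!: primes_leD)
  have "(1 - (real N + 1) powr (-d)) / d \<le> (\<Sum>m\<in>{1..N}. real m powr (-1 - d))"
    by (rule zeta_partial_sum_ge[OF assms])
  also have "\<dots> \<le> (\<Sum>m | m dvd ?M. real m powr (-1 - d))"
    using M by (intro sum_mono2) (auto intro!: dvd_prod_primes_le)
  also have "\<dots> = (\<Prod>p\<in>primes_le N. \<Sum>i\<le>N. (real p powr (-1 - d)) ^ i)"
    by (rule euler_product_divisors) (auto dest: primes_leD)
  also have "\<dots> \<le> (\<Prod>p\<in>primes_le N. 1 / (1 - real p powr (-1 - d)))"
  proof (rule prod_mono, rule conjI)
    fix p assume "p \<in> primes_le N"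
    hence p: "real p powr (-1 - d) < 1" "real p powr (-1 - d) > 0"
      using euler_factor_less_1[of p d] assms by (auto dest!: primes_leD)
    show "0 \<le> (\<Sum>i\<le>N. (real p powr (-1 - d)) ^ i)" by (intro sum_nonneg) auto
    have "(1 - real p powr (-1 - d)) * (\<Sum>i\<le>N. (real p powr (-1 - d)) ^ i) \<le> 1"
      unfolding sum_gp_basic using p by simp
    thus "(\<Sum>i\<le>N. (real p powr (-1 - d)) ^ i) \<le> 1 / (1 - real p powr (-1 - d))"
      using p by (simp add: field_simps)
  qed
  finally show ?thesis .
qed

section \<open>The product over primes up to powers of two\<close>

definition log_euler_factor :: "nat \<Rightarrow> real" where
  "log_euler_factor p = - ln (1 - 1 / real p)"

lemma neg_ln_one_minus_bounds:
  fixes t :: real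
  assumes "0 \<le> t" "t \<le> 1/2"
  shows "t \<le> - ln (1 - t)" "- ln (1 - t) \<le> t + 2 * t\<^sup>2"
  using ln_one_minus_pos_upper_bound[of t] ln_one_minus_pos_lower_bound[of t] assms by auto

text \<open>Damping the argument \<open>t\<close> of \<open>- ln (1 - t)\<close> by \<open>w\<close> is nearly the same as multiplying the value by
\<open>w\<close>, as the two agree in the linear term. The remainder \<open>h t = - ln (1 - t) - t\<close> is of size \<open>t\<^sup>2\<close>
and has derivative at most \<open>2 * t\<close> on \<open>[0, 1/2]\<close>.\<close>

lemma log_euler_factor_shift:
  fixes t w :: real
  assumes t: "0 < t" "t \<le> 1/2" and w: "0 \<le> w" "w \<le> 1"
  shows "\<bar>w * (- ln (1 - t)) - (- ln (1 - w * t))\<bar> \<le> 2 * t\<^sup>2 * (1 - w)"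
proof -
  define u where "u = w * t"
  define h where "h x = - ln (1 - x) - x" for x :: real
  have u: "0 \<le> u" "u \<le> t" using t w by (auto simp: u_def mult_left_le_one_le)
  have tu: "t - u = t * (1 - w)" by (simp add: u_def algebra_simps)
  have h0: "0 \<le> h t" "h t \<le> 2 * t\<^sup>2" using neg_ln_one_minus_bounds[of t] t by (auto simp: h_def)
  have "h t - h u = ln ((1 - u) / (1 - t)) - (t - u)" using t u by (simp add: h_def ln_div)
  also have "\<dots> \<le> (1 - u) / (1 - t) - 1 - (t - u)"
    using t u ln_le_minus_one[of "(1 - u) / (1 - t)"] by simp
  also have "\<dots> = (t - u) * (t / (1 - t))" using t by (simp add: field_simps)
  also have "\<dots> \<le> (t - u) * (2 * t)"
    using t u mult_left_mono[of "1/2" "1 - t" t] by (intro mult_left_mono) (auto simp: field_simps)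
  finally have h1: "h t - h u \<le> 2 * t\<^sup>2 * (1 - w)" unfolding tu by (simp add: power2_eq_square algebra_simps)
  have "ln ((1 - t) / (1 - u)) \<le> (1 - t) / (1 - u) - 1" using t u by (intro ln_le_minus_one) simp
  also have "\<dots> = - ((t - u) / (1 - u))" using t u by (simp add: field_simps)
  also have "\<dots> \<le> - (t - u)" using t u divide_left_mono[of "1 - u" 1 "t - u"] by simp
  finally have h2: "h u \<le> h t" using t u by (simp add: h_def ln_div)
  have e: "w * (- ln (1 - t)) - (- ln (1 - w * t)) = w * h t - h u"
    by (simp add: h_def u_def algebra_simps)
  have "w * h t \<le> h t" using h0 w by (simp add: mult_left_le_one_le)
  moreover have "(1 - w) * h t \<le> (1 - w) * (2 * t\<^sup>2)" using h0 w by (intro mult_left_mono) auto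
  ultimately show ?thesis unfolding e using h1 h2 by (simp add: abs_le_iff algebra_simps)
qed

text \<open>The case \<open>t = 1 / p\<close>, \<open>w = p powr (- d)\<close>, with \<open>1 - w \<le> d * ln p\<close>. Summed over all primes, passing
from \<open>1 / p\<close> to \<open>p powr (-1 - d)\<close> thus costs only \<open>O(d)\<close>.\<close>

lemma log_euler_factor_powr_bound:
  assumes p: "p \<ge> 2" and d: "d > 0"
  shows "\<bar>real p powr (-d) * log_euler_factor p - (- ln (1 - real p powr (-1 - d)))\<bar>
      \<le> 2 * d * (ln (real p) / real p ^ 2)"
proof -
  let ?w = "real p powr (-d)" and ?t = "1 / real p"
  have wt: "?w * ?t = real p powr (-1 - d)" using p by (simp add: powr_diff powr_minus field_simps)
  have w1: "?w \<le> 1" using p d powr_mono[of "-d" 0 "real p"] by simp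
  have "\<bar>?w * (- ln (1 - ?t)) - (- ln (1 - ?w * ?t))\<bar> \<le> 2 * ?t\<^sup>2 * (1 - ?w)"
    using p w1 by (intro log_euler_factor_shift) (auto simp: field_simps)
  also have "1 - ?w \<le> d * ln (real p)"
    using p exp_ge_add_one_self[of "- d * ln (real p)"] by (simp add: powr_def)
  hence "2 * ?t\<^sup>2 * (1 - ?w) \<le> 2 * ?t\<^sup>2 * (d * ln (real p))" by (intro mult_left_mono) auto
  finally show ?thesis unfolding wt by (simp add: log_euler_factor_def power_one_over mult_ac)
qed

definition dyadic_log_factor :: "nat \<Rightarrow> real" where
  "dyadic_log_factor j = sum log_euler_factor (dyadic_primes j)"

lemma log_euler_factor_bounds:
  assumes "p \<ge> 2"
  shows "1 / real p \<le> log_euler_factor p" "log_euler_factor p \<le> 1 / real p + 2 / real p ^ 2"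
        "0 \<le> log_euler_factor p"
proof -
  show "1 / real p \<le> log_euler_factor p" "log_euler_factor p \<le> 1 / real p + 2 / real p ^ 2"
    using neg_ln_one_minus_bounds[of "1 / real p"] assms
    by (auto simp: log_euler_factor_def field_simps power2_eq_square)
  thus "0 \<le> log_euler_factor p" using order.trans[of 0 "1 / real p"] by simp
qed

lemma dyadic_log_factor_nonneg: "dyadic_log_factor j \<ge> 0"
  unfolding dyadic_log_factor_def
  by (intro sum_nonneg log_euler_factor_bounds(3)) (auto dest: dyadic_primesD)

lemma ln_dyadic_prime:
  assumes "p \<in> dyadic_primes j"
  shows "real j * ln 2 \<le> ln (real p)" "ln (real p) \<le> real (Suc j) * ln 2" 
        "real (Suc j) * ln 2 \<le> 2 * ln (real p)"
proof -
  note D = dyadic_primesD[OF assms]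
  have "real (2 ^ j) \<le> real p" using D unfolding of_nat_le_iff by simp
  hence "ln (real (2 ^ j)) \<le> ln (real p)" using D by (subst ln_le_cancel_iff) auto
  thus 1: "real j * ln 2 \<le> ln (real p)" by (simp add: ln_realpow)
  have "real p \<le> real (2 ^ Suc j)" using D unfolding of_nat_le_iff by simp
  hence "ln (real p) \<le> ln (real (2 ^ Suc j))" using D by (subst ln_le_cancel_iff) auto
  thus "ln (real p) \<le> real (Suc j) * ln 2" by (simp add: ln_realpow del: power_Suc)
  have "ln 2 \<le> ln (real p)" using D by (subst ln_le_cancel_iff) auto
  thus "real (Suc j) * ln 2 \<le> 2 * ln (real p)"
    using 1 by (simp add: algebra_simps)
qed

text \<open>On a dyadic block \<open>1 / p\<close> is close to \<open>(ln p / p) / ((j + 1) * ln 2)\<close>. By Mertens' first theorem the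
block sums of \<open>ln p / p\<close> minus \<open>ln 2\<close> have bounded partial sums, so Dirichlet's test applies to the
main part; the remainders are quadratic in \<open>1 / p\<close> or in \<open>1 / (j + 1)\<close>.\<close>

lemma summable_dyadic_log_factor_diff:
  "summable (\<lambda>j. dyadic_log_factor j - 1 / real (Suc j))"
proof -
  obtain C where C: "\<And>n. \<bar>(\<Sum>p\<in>primes_le (2 ^ n). ln (real p) / real p) - real n * ln 2\<bar> \<le> C"
    using mertens_first_dyadic by blast
  obtain K where K: "\<And>A. finite A \<Longrightarrow> (\<Sum>p\<in>A. ln (real p) / real p ^ 2) \<le> K"
    using sum_ln_over_square_bounded by blast
  define a where "a j = (\<Sum>p\<in>dyadic_primes j. ln (real p) / real p)" for j
  define q where "q j = (\<Sum>p\<in>dyadic_primes j. ln (real p) / real p ^ 2)" for j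
  have ln2: "ln 2 > (0::real)" by simp
  have asum: "(\<Sum>j<n. a j) = (\<Sum>p\<in>primes_le (2 ^ n). ln (real p) / real p)" for n
    unfolding a_def by (rule sum_dyadic_primes)
  have main: "summable (\<lambda>j. (a j / ln 2 - 1) / real (Suc j))"
  proof (rule summable_over_index)
    fix n
    have "(\<Sum>j<n. a j / ln 2 - 1) = ((\<Sum>j<n. a j) - real n * ln 2) / ln 2"
      by (simp add: sum_subtractf sum_divide_distrib[symmetric] diff_divide_distrib)
    thus "\<bar>\<Sum>j<n. a j / ln 2 - 1\<bar> \<le> C / ln 2"
      using C[of n] by (simp add: asum divide_right_mono)
  qed
  have a_le: "a j \<le> 2 * C + ln 2" for j
  proof -
    have "a j = (\<Sum>i<Suc j. a i) - (\<Sum>i<j. a i)" by simp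
    also have "\<dots> \<le> 2 * C + ln 2"
      using C[of "Suc j"] C[of j] unfolding asum abs_le_iff by (simp add: algebra_simps)
    finally show ?thesis .
  qed
  have a_nonneg: "a j \<ge> 0" for j
    unfolding a_def by (intro sum_nonneg divide_nonneg_nonneg) (auto dest!: dyadic_primesD)
  have q_nonneg: "q j \<ge> 0" for j
    unfolding q_def by (intro sum_nonneg divide_nonneg_nonneg) (auto dest!: dyadic_primesD)
  have q: "summable q"
  proof (rule bounded_imp_summable[of _ K])
    fix n
    have "(\<Sum>j\<le>n. q j) = (\<Sum>p\<in>primes_le (2 ^ Suc n). ln (real p) / real p ^ 2)"
      unfolding q_def lessThan_Suc_atMost[symmetric] by (rule sum_dyadic_primes)
    also have "\<dots> \<le> K" by (rule K) simp
    finally show "(\<Sum>j\<le>n. q j) \<le> K" .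
  qed (rule q_nonneg)
  have rest: "summable (\<lambda>j. dyadic_log_factor j - a j / (real (Suc j) * ln 2))"
  proof (rule summable_comparison_test')
    have "summable (\<lambda>j. 1 / real (Suc j) ^ 2)"
      using inverse_power_summable[of 2, where 'a = real] by (subst summable_Suc_iff) (simp add: inverse_eq_divide)
    thus "summable (\<lambda>j. 4 * q j + (2 * (2 * C + ln 2) / ln 2) * (1 / real (Suc j) ^ 2))"
      by (intro summable_add summable_mult q)
    fix j
    let ?L = "real (Suc j) * ln 2"
    have L: "?L > 0" using ln2 by simp
    have diff: "dyadic_log_factor j - a j / ?L
        = (\<Sum>p\<in>dyadic_primes j. log_euler_factor p - ln (real p) / real p / ?L)"
      by (simp add: dyadic_log_factor_def a_def sum_subtractf sum_divide_distrib)
    have bounds: "0 \<le> log_euler_factor p - ln (real p) / real p / ?L \<and>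
        log_euler_factor p - ln (real p) / real p / ?L
         \<le> 4 * (ln (real p) / real p ^ 2) + 2 / (real (Suc j) * ?L) * (ln (real p) / real p)"
      if p: "p \<in> dyadic_primes j" for p
    proof -
      note D = dyadic_primesD[OF p]
      note B = ln_dyadic_prime[OF p]
      have p2: "p \<ge> 2" using D by simp
      have p0: "real p > 0" using p2 by simp
      note G = log_euler_factor_bounds[OF p2]
      have "ln (real p) / real p / ?L = (1 / real p) * (ln (real p) / ?L)" by simp
      also have "\<dots> \<le> (1 / real p) * 1" using B L by (intro mult_left_mono) auto
      finally have 1: "ln (real p) / real p / ?L \<le> 1 / real p" by simp
      have "real j * ln 2 / ?L \<le> ln (real p) / ?L" using B L by (intro divide_right_mono) auto
      moreover have "real j * ln 2 / ?L = real j / real (Suc j)" by (simp del: of_nat_Suc)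
      moreover have "real j / real (Suc j) = 1 - 1 / real (Suc j)" by (simp add: field_simps)
      ultimately have "1 - ln (real p) / ?L \<le> 1 / real (Suc j)" by linarith
      also have "1 / real (Suc j) \<le> 1 / real (Suc j) * (2 * ln (real p) / ?L)"
        using B L mult_left_mono[of 1 "2 * ln (real p) / ?L" "1 / real (Suc j)"] by (simp del: of_nat_Suc)
      finally have "(1 / real p) * (1 - ln (real p) / ?L) \<le> (1 / real p) * (1 / real (Suc j) * (2 * ln (real p) / ?L))"
        by (intro mult_left_mono) auto
      hence 2: "1 / real p - ln (real p) / real p / ?L \<le> 2 / (real (Suc j) * ?L) * (ln (real p) / real p)"
        by (simp add: algebra_simps)
      \<comment> \<open>As \<open>2 * ln p \<ge> 1\<close>, the terms \<open>2 / p\<^sup>2\<close> are covered by the bounded sum of \<open>ln p / p\<^sup>2\<close>.\<close>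
      have "ln 2 \<le> ln (real p)" using p2 by (subst ln_le_cancel_iff) auto
      moreover note ln2_ge_half
      ultimately have "2 / real p ^ 2 \<le> 4 * ln (real p) / real p ^ 2"
        by (intro divide_right_mono) auto
      thus ?thesis using 1 2 G by simp
    qed
    have b1: "dyadic_log_factor j - a j / ?L \<ge> 0" unfolding diff using bounds by (intro sum_nonneg) auto
    have b2: "dyadic_log_factor j - a j / ?L \<le> 4 * q j + 2 / (real (Suc j) * ?L) * a j"
    proof -
      have "dyadic_log_factor j - a j / ?L \<le> (\<Sum>p\<in>dyadic_primes j.
          4 * (ln (real p) / real p ^ 2) + 2 / (real (Suc j) * ?L) * (ln (real p) / real p))"
        unfolding diff using bounds by (intro sum_mono) auto
      also have "\<dots> = 4 * q j + 2 / (real (Suc j) * ?L) * a j"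
        by (simp only: sum.distrib sum_distrib_left q_def a_def)
      finally show ?thesis .
    qed
    have b3: "2 / (real (Suc j) * ?L) * a j \<le> 2 / (real (Suc j) * ?L) * (2 * C + ln 2)"
      using L a_le by (intro mult_left_mono) auto
    have b4: "2 / (real (Suc j) * ?L) * (2 * C + ln 2) = (2 * (2 * C + ln 2) / ln 2) * (1 / real (Suc j) ^ 2)"
      by (simp add: power2_eq_square)
    show "norm (dyadic_log_factor j - a j / ?L)
        \<le> 4 * q j + (2 * (2 * C + ln 2) / ln 2) * (1 / real (Suc j) ^ 2)"
      unfolding real_norm_def abs_of_nonneg[OF b1] using b2 b3 b4 by linarith
  qed
  have "(\<lambda>j. dyadic_log_factor j - 1 / real (Suc j)) =
     (\<lambda>j. (a j / ln 2 - 1) / real (Suc j) + (dyadic_log_factor j - a j / (real (Suc j) * ln 2)))"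
    by (simp add: diff_divide_distrib mult.commute)
  thus ?thesis using summable_add[OF main rest] by simp
qed

lemma powr_dyadic_prime:
  assumes "p \<in> dyadic_primes j" "d > 0"
  shows "(2 powr (-d)) ^ Suc j \<le> real p powr (-d)" "real p powr (-d) \<le> (2 powr (-d)) ^ j"
proof -
  note D = dyadic_primesD[OF assms(1)]
  have e: "(2 powr (-d)) ^ k = real (2 ^ k) powr (-d)" for k
    by (simp add: powr_realpow[symmetric] powr_powr mult.commute)
  have "real p \<le> real (2 ^ Suc j)" "real (2 ^ j) \<le> real p" using D unfolding of_nat_le_iff by auto
  thus "(2 powr (-d)) ^ Suc j \<le> real p powr (-d)" "real p powr (-d) \<le> (2 powr (-d)) ^ j"
    unfolding e using D assms(2) by (auto intro!: powr_mono2' simp del: power_Suc)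
qed

lemma ln_euler_product:
  assumes "d > 0"
  shows "ln (\<Prod>p\<in>primes_le N. 1 / (1 - real p powr (-1 - d)))
       = (\<Sum>p\<in>primes_le N. - ln (1 - real p powr (-1 - d)))"
proof -
  have f: "1 - real p powr (-1 - d) > 0" if "p \<in> primes_le N" for p
    using euler_factor_less_1[of p d] assms primes_leD[OF that] by simp
  have "ln (\<Prod>p\<in>primes_le N. 1 / (1 - real p powr (-1 - d)))
      = (\<Sum>p\<in>primes_le N. ln (1 / (1 - real p powr (-1 - d))))"
    using f by (intro ln_prod) force+
  also have "\<dots> = (\<Sum>p\<in>primes_le N. - ln (1 - real p powr (-1 - d)))"
    using f by (intro sum.cong refl) (force simp: ln_div)
  finally show ?thesis .
qed

text \<open>On block \<open>j\<close> the factor \<open>p powr (- d)\<close> lies between \<open>z ^ (j + 1)\<close> and \<open>z ^ j\<close> for \<open>z = 2 powr (- d)\<close>.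
So up to a factor \<open>z\<close> the power series is the sum of \<open>p powr (- d)\<close> times the logarithmic Euler factor
at \<open>1\<close>, which is the logarithm of the Euler product at \<open>1 + d\<close> up to \<open>O(d)\<close>.\<close>

lemma dyadic_log_series_bounds:
  "\<exists>K. \<forall>d>0. 2 powr (-d) * (- ln d - K * d) \<le> (\<Sum>j. dyadic_log_factor j * (2 powr (-d)) ^ Suc j) \<and>
      (\<Sum>j. dyadic_log_factor j * (2 powr (-d)) ^ Suc j) \<le> ln (1 + 1 / d) + K * d \<and>
      summable (\<lambda>j. dyadic_log_factor j * (2 powr (-d)) ^ Suc j)"
proof -
  obtain K where K: "\<And>A. finite A \<Longrightarrow> (\<Sum>p\<in>A. ln (real p) / real p ^ 2) \<le> K"
    using sum_ln_over_square_bounded by blast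
  have main: "2 powr (-d) * (- ln d - 2 * K * d) \<le> (\<Sum>j. dyadic_log_factor j * (2 powr (-d)) ^ Suc j) \<and>
      (\<Sum>j. dyadic_log_factor j * (2 powr (-d)) ^ Suc j) \<le> ln (1 + 1 / d) + 2 * K * d \<and>
      summable (\<lambda>j. dyadic_log_factor j * (2 powr (-d)) ^ Suc j)" if d: "d > 0" for d
  proof -
    define z where "z = 2 powr (-d)"
    have z: "z > 0" by (simp add: z_def)
    define G where "G n = (\<Sum>p\<in>primes_le (2 ^ n). real p powr (-d) * log_euler_factor p)" for n
    define Z where "Z n = (\<Prod>p\<in>primes_le (2 ^ n). 1 / (1 - real p powr (-1 - d)))" for n
    define E where "E n = (\<Sum>j<n. dyadic_log_factor j * z ^ Suc j)" for n
    have Zpos: "Z n > 0" for n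
      unfolding Z_def using euler_factor_less_1[OF _ d] by (intro prod_pos) (auto dest: primes_leD)
    have GZ: "\<bar>G n - ln (Z n)\<bar> \<le> 2 * K * d" for n
    proof -
      have "\<bar>G n - ln (Z n)\<bar> = \<bar>\<Sum>p\<in>primes_le (2 ^ n). real p powr (-d) * log_euler_factor p - (- ln (1 - real p powr (-1 - d)))\<bar>"
        unfolding G_def Z_def ln_euler_product[OF d] by (simp only: sum_subtractf)
      also have "\<dots> \<le> (\<Sum>p\<in>primes_le (2 ^ n). 2 * d * (ln (real p) / real p ^ 2))"
        by (intro order.trans[OF sum_abs] sum_mono log_euler_factor_powr_bound d) (auto dest: primes_leD)
      also have "\<dots> = 2 * d * (\<Sum>p\<in>primes_le (2 ^ n). ln (real p) / real p ^ 2)"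
        by (simp add: sum_distrib_left)
      also have "\<dots> \<le> 2 * d * K" using d K by (intro mult_left_mono) auto
      finally show ?thesis by (simp add: mult_ac)
    qed
    have Gsum: "G n = (\<Sum>j<n. \<Sum>p\<in>dyadic_primes j. real p powr (-d) * log_euler_factor p)" for n
      unfolding G_def by (rule sum_dyadic_primes[symmetric])
    have EG: "E n \<le> G n" for n
      unfolding E_def Gsum dyadic_log_factor_def sum_distrib_right
      by (intro sum_mono)
         (auto simp: z_def mult.commute[of "log_euler_factor _"] simp del: power_Suc
               intro!: mult_right_mono powr_dyadic_prime log_euler_factor_bounds d dest: dyadic_primesD)
    have GE: "z * G n \<le> E n" for n
      unfolding E_def Gsum dyadic_log_factor_def sum_distrib_right sum_distrib_left
    proof (intro sum_mono)
      fix j p assume p: "p \<in> dyadic_primes j"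
      have "z * (real p powr (-d) * log_euler_factor p) \<le> z * (z ^ j * log_euler_factor p)"
        using z powr_dyadic_prime(2)[OF p d] log_euler_factor_bounds(3)[of p] dyadic_primesD[OF p]
        by (intro mult_left_mono mult_right_mono) (auto simp: z_def)
      thus "z * (real p powr (-d) * log_euler_factor p) \<le> log_euler_factor p * z ^ Suc j"
        by (simp add: mult_ac)
    qed
    have up: "E n \<le> ln (1 + 1 / d) + 2 * K * d" for n
    proof -
      have "ln (Z n) \<le> ln (1 + 1 / d)"
        using Zpos[of n] euler_product_le[OF d, of "2 ^ n"] unfolding Z_def by (subst ln_le_cancel_iff) (auto simp: Z_def add_pos_pos d)
      thus ?thesis using EG[of n] GZ[of n] by (simp add: abs_le_iff)
    qed
    have terms: "dyadic_log_factor j * z ^ Suc j \<ge> 0" for j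
      using z dyadic_log_factor_nonneg by (intro mult_nonneg_nonneg) auto
    have summ: "summable (\<lambda>j. dyadic_log_factor j * z ^ Suc j)"
      using terms up unfolding E_def
      by (intro bounded_imp_summable[of _ "ln (1 + 1 / d) + 2 * K * d"]) (auto simp flip: lessThan_Suc_atMost simp del: power_Suc sum.lessThan_Suc)
    hence lim: "E \<longlonglongrightarrow> (\<Sum>j. dyadic_log_factor j * z ^ Suc j)" (is "_ \<longlonglongrightarrow> ?S")
      unfolding E_def by (rule summable_LIMSEQ)
    have upS: "?S \<le> ln (1 + 1 / d) + 2 * K * d"
      using lim up by (intro LIMSEQ_le_const2[OF lim]) auto
    have low: "z * (ln ((1 - (real (2 ^ n) + 1) powr (-d)) / d) - 2 * K * d) \<le> E n" for n
    proof -
      have "(real (2 ^ n) + 1) powr (-d) < 1 powr (-d)" using d by (intro powr_less_mono2_neg) auto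
      hence "0 < (1 - (real (2 ^ n) + 1) powr (-d)) / d" using d by simp
      hence "ln ((1 - (real (2 ^ n) + 1) powr (-d)) / d) \<le> ln (Z n)"
        using Zpos[of n] euler_product_ge[OF d, of "2 ^ n"] unfolding Z_def by (subst ln_le_cancel_iff) auto
      hence "ln ((1 - (real (2 ^ n) + 1) powr (-d)) / d) - 2 * K * d \<le> G n"
        using GZ[of n] by (simp add: abs_le_iff)
      hence "z * (ln ((1 - (real (2 ^ n) + 1) powr (-d)) / d) - 2 * K * d) \<le> z * G n"
        using z by (intro mult_left_mono) auto
      also have "\<dots> \<le> E n" by (rule GE)
      finally show ?thesis .
    qed
    have "(\<lambda>n. (real (2 ^ n) + 1) powr (-d)) \<longlonglongrightarrow> 0" using d by real_asymp
    hence "(\<lambda>n. z * (ln ((1 - (real (2 ^ n) + 1) powr (-d)) / d) - 2 * K * d)) \<longlonglongrightarrow> z * (ln ((1 - 0) / d) - 2 * K * d)"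
      using d by (intro tendsto_intros) auto
    hence "z * (ln ((1 - 0) / d) - 2 * K * d) \<le> ?S" using low by (intro LIMSEQ_le[OF _ lim]) auto
    thus ?thesis using upS summ d unfolding z_def by (simp add: ln_div)
  qed
  show ?thesis by (rule exI[of _ "2 * K"]) (use main in blast)
qed

lemma ln_one_minus_series:
  fixes z :: real
  assumes "0 < z" "z < 1"
  shows "(\<lambda>j. z ^ Suc j / real (Suc j)) sums (- ln (1 - z))"
proof -
  have summ: "summable (\<lambda>j. z ^ Suc j / real (Suc j))"
  proof (rule summable_comparison_test')
    show "summable (\<lambda>j. z ^ j)" using assms by (intro summable_geometric) auto
    fix j
    have "z ^ Suc j / real (Suc j) \<le> z ^ Suc j / 1" using assms by (intro divide_left_mono) auto
    also have "\<dots> \<le> z ^ j" using assms by (simp add: mult_left_le_one_le)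
    finally show "norm (z ^ Suc j / real (Suc j)) \<le> z ^ j" using assms by simp
  qed
  have "- ln (1 - z) = (\<Sum>j. z ^ Suc j / real (Suc j))"
  proof -
    have "ln (1 - z) = (\<Sum>n. (-1) ^ n * (1 / real (n + 1)) * ((1 - z) - 1) ^ Suc n)"
      using assms by (intro ln_series) auto
    also have "(\<lambda>n. (-1) ^ n * (1 / real (n + 1)) * ((1 - z) - 1) ^ Suc n) = (\<lambda>j. - (z ^ Suc j / real (Suc j)))"
    proof
      fix n
      have eq: "((1 - z) - 1) ^ Suc n = - ((-1) ^ n * z ^ Suc n)" using power_minus[of z "Suc n"] by simp
      have "(-1) ^ n * (1 / real (n + 1)) * ((1 - z) - 1) ^ Suc n
          = - (((-1) ^ n * (-1) ^ n) * (z ^ Suc n / real (Suc n)))"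
        unfolding eq by (simp add: mult_ac)
      also have "(-1::real) ^ n * (-1) ^ n = 1" by (simp flip: power_mult_distrib)
      finally show "(-1) ^ n * (1 / real (n + 1)) * ((1 - z) - 1) ^ Suc n = - (z ^ Suc n / real (Suc n))"
        by simp
    qed
    also have "suminf \<dots> = - (\<Sum>j. z ^ Suc j / real (Suc j))"
      by (rule suminf_minus[OF summ])
    finally show ?thesis by simp
  qed
  thus ?thesis using summable_sums[OF summ] by simp
qed

text \<open>The sum over the blocks of \<open>b\<^sub>j - 1 / (j + 1)\<close> converges, and Abel's theorem identifies its limit: the
power series with \<open>z = 2 powr (- d)\<close> behaves like \<open>ln ((1 - 2 powr (- d)) / d)\<close>, which tends to \<open>ln (ln 2)\<close>
as \<open>d\<close> tends to \<open>0\<close> from above.\<close>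

theorem mertens_third_log:
  "(\<lambda>n. sum log_euler_factor (primes_le (2 ^ n)) - harm n) \<longlonglongrightarrow> ln (ln 2)"
proof -
  define c where "c j = dyadic_log_factor j - 1 / real (Suc j)" for j
  define l where "l = suminf c"
  have c: "c sums l" using summable_dyadic_log_factor_diff unfolding c_def l_def by (rule summable_sums)
  let ?S = "\<lambda>d::real. \<Sum>j. dyadic_log_factor j * (2 powr (-d)) ^ Suc j"
  from dyadic_log_series_bounds obtain K where
    K0: "\<forall>d>0. 2 powr (-d) * (- ln d - K * d) \<le> ?S d \<and> ?S d \<le> ln (1 + 1 / d) + K * d \<and>
          summable (\<lambda>j. dyadic_log_factor j * (2 powr (-d)) ^ Suc j)" ..
  have K: "2 powr (-d) * (- ln d - K * d) \<le> ?S d" "?S d \<le> ln (1 + 1 / d) + K * d"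
      "summable (\<lambda>j. dyadic_log_factor j * (2 powr (-d)) ^ Suc j)" if "d > 0" for d
    using K0 that by (simp_all del: power_Suc)
  have rel: "2 powr (-d) * (\<Sum>j. c j * (2 powr (-d)) ^ j)
      = (\<Sum>j. dyadic_log_factor j * (2 powr (-d)) ^ Suc j) + ln (1 - 2 powr (-d))" if d: "d > 0" for d :: real
  proof -
    define z :: real where "z = 2 powr (-d)"
    have "2 powr (-d) < 2 powr (0::real)" using d by (intro powr_less_mono) auto
    hence z: "0 < z" "z < 1" by (auto simp: z_def)
    have s: "(\<lambda>j. dyadic_log_factor j * z ^ Suc j - z ^ Suc j / real (Suc j)) sums
        ((\<Sum>j. dyadic_log_factor j * z ^ Suc j) - (- ln (1 - z)))"
      using K(3)[OF d] z by (intro sums_diff ln_one_minus_series summable_sums) (auto simp: z_def)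
    have "(\<lambda>j. dyadic_log_factor j * z ^ Suc j - z ^ Suc j / real (Suc j)) = (\<lambda>j. z * (c j * z ^ j))"
      by (simp add: c_def fun_eq_iff algebra_simps)
    with s have s': "(\<lambda>j. z * (c j * z ^ j)) sums ((\<Sum>j. dyadic_log_factor j * z ^ Suc j) + ln (1 - z))" by simp
    hence "(\<lambda>j. inverse z * (z * (c j * z ^ j))) sums
       (inverse z * ((\<Sum>j. dyadic_log_factor j * z ^ Suc j) + ln (1 - z)))" by (rule sums_mult)
    hence "(\<lambda>j. c j * z ^ j) sums (inverse z * ((\<Sum>j. dyadic_log_factor j * z ^ Suc j) + ln (1 - z)))"
      using z by (simp add: mult.assoc[symmetric])
    hence "z * (\<Sum>j. c j * z ^ j) = (\<Sum>j. dyadic_log_factor j * z ^ Suc j) + ln (1 - z)"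
      using z by (simp add: sums_iff)
    thus ?thesis by (simp add: z_def)
  qed
  have "filterlim (\<lambda>d::real. 2 powr (-d)) (at_left 1) (at_right 0)" by real_asymp
  from filterlim_compose[OF abel_limit[OF c] this]
  have A: "((\<lambda>d. \<Sum>j. c j * (2 powr (-d)) ^ j) \<longlongrightarrow> l) (at_right 0)" .
  have "((\<lambda>d::real. 2 powr (-d)) \<longlongrightarrow> 1) (at_right 0)" by real_asymp
  from tendsto_mult[OF this A]
  have l1: "((\<lambda>d. 2 powr (-d) * (\<Sum>j. c j * (2 powr (-d)) ^ j)) \<longlongrightarrow> l) (at_right 0)" by simp
  have pos: "\<forall>\<^sub>F d in at_right 0. d > (0::real)" by (simp add: eventually_at_right_less)
  have l2: "((\<lambda>d. 2 powr (-d) * (\<Sum>j. c j * (2 powr (-d)) ^ j)) \<longlongrightarrow> ln (ln 2)) (at_right 0)"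
  proof (rule tendsto_sandwich)
    show "\<forall>\<^sub>F d in at_right 0. 2 powr (-d) * (- ln d - K * d) + ln (1 - 2 powr (-d))
        \<le> 2 powr (-d) * (\<Sum>j. c j * (2 powr (-d)) ^ j)"
      using pos by eventually_elim (use rel K(1) in simp)
    show "\<forall>\<^sub>F d in at_right 0. 2 powr (-d) * (\<Sum>j. c j * (2 powr (-d)) ^ j)
        \<le> ln (1 + 1 / d) + K * d + ln (1 - 2 powr (-d))"
      using pos by eventually_elim (use rel K(2) in simp)
    show "((\<lambda>d. 2 powr (-d) * (- ln d - K * d) + ln (1 - 2 powr (-d))) \<longlongrightarrow> ln (ln 2)) (at_right 0)"
      by real_asymp
    show "((\<lambda>d. ln (1 + 1 / d) + K * d + ln (1 - 2 powr (-d))) \<longlongrightarrow> ln (ln 2)) (at_right 0)"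
      by real_asymp
  qed
  have "l = ln (ln 2)" using tendsto_unique[OF _ l1 l2] by simp
  moreover have "(\<lambda>n. \<Sum>j<n. c j) \<longlonglongrightarrow> l" using c by (simp add: sums_def)
  moreover have "(\<Sum>j<n. c j) = sum log_euler_factor (primes_le (2 ^ n)) - harm n" for n
  proof -
    have "(\<Sum>j<n. 1 / real (Suc j)) = harm n" by (induction n) (simp_all add: harm_def inverse_eq_divide)
    thus ?thesis
      by (simp add: c_def sum_subtractf dyadic_log_factor_def sum_dyadic_primes)
  qed
  ultimately show ?thesis by simp
qed

definition mertens_product :: "nat \<Rightarrow> real" where
  "mertens_product n = (\<Prod>p\<in>primes_le (2 ^ n). 1 / (1 - 1 / real p))"

theorem mertens_third_dyadic:
  "(\<lambda>n. mertens_product n / (real n * ln 2)) \<longlonglongrightarrow> exp euler_mascheroni"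
proof -
  have "(\<lambda>n. exp ((sum log_euler_factor (primes_le (2 ^ n)) - harm n) + (harm n - ln (real n))))
     \<longlonglongrightarrow> exp (ln (ln 2) + euler_mascheroni)"
    by (intro tendsto_intros mertens_third_log euler_mascheroni_LIMSEQ)
  hence lim: "(\<lambda>n. exp (sum log_euler_factor (primes_le (2 ^ n)) - ln (real n)) / ln 2)
     \<longlonglongrightarrow> exp (ln (ln 2) + euler_mascheroni) / ln 2"
    by (intro tendsto_divide tendsto_const) simp_all
  have "\<forall>\<^sub>F n in sequentially. exp (sum log_euler_factor (primes_le (2 ^ n)) - ln (real n)) / ln 2
      = mertens_product n / (real n * ln 2)"
    using eventually_gt_at_top[of 0]
  proof eventually_elim
    case (elim n)
    have "exp (sum log_euler_factor (primes_le (2 ^ n))) = (\<Prod>p\<in>primes_le (2 ^ n). exp (log_euler_factor p))"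
      by (simp add: exp_sum)
    also have "\<dots> = mertens_product n"
      unfolding mertens_product_def
    proof (rule prod.cong[OF refl])
      fix p :: nat assume "p \<in> primes_le (2 ^ n)"
      hence "1 - 1 / real p > 0" by (auto dest!: primes_leD)
      thus "exp (log_euler_factor p) = 1 / (1 - 1 / real p)"
        by (simp add: log_euler_factor_def exp_minus inverse_eq_divide)
    qed
    finally show ?case using elim by (simp add: exp_diff)
  qed
  from Lim_transform_eventually[OF lim this] show ?thesis by (simp add: exp_add)
qed

section \<open>The upper bound\<close>

text \<open>The tangent of \<open>ln\<close> at \<open>T\<close> bounds the inner logarithm; the extra summand \<open>1\<close> covers the truncated
values of the iterated logarithm.\<close>

lemma Psi_upper:
  assumes n: "n > 0" and T: "T \<ge> 1"
  shows "Psi n \<le> (1 + ln T) * divisor_moment 1 n + divisor_moment 2 n / T"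
proof -
  have "Psi n \<le> (\<Sum>d | d dvd n. (1 + ln T) * (ln (real d) ^ 1 / real d) + (ln (real d) ^ 2 / real d) / T)"
    unfolding Psi_def
  proof (rule sum_mono)
    fix d assume "d \<in> {d. d dvd n}"
    hence d: "d > 0" using n by (auto intro: dvd_pos_nat)
    let ?t = "ln (real d)"
    have t: "?t \<ge> 0" using d by simp
    have "loglog (real d) \<le> 1 + ln T + ?t / T"
    proof (cases "real d \<le> exp (exp 1)")
      case True
      thus ?thesis using t T by (simp add: loglog_def)
    next
      case False
      hence "?t > exp 1" using d by (metis exp_less_cancel_iff exp_ln not_le of_nat_0_less_iff)
      hence t0: "?t > 0" using exp_gt_zero[of "1::real"] by linarith
      have "ln ?t = ln T + ln (?t / T)" using t0 T by (simp add: ln_div)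
      also have "ln (?t / T) \<le> ?t / T - 1" using t0 T by (intro ln_le_minus_one) auto
      finally show ?thesis using False by (simp add: loglog_def)
    qed
    hence "?t * loglog (real d) / real d \<le> ?t * (1 + ln T + ?t / T) / real d"
      using t by (intro divide_right_mono mult_left_mono) auto
    also have "\<dots> = (1 + ln T) * (?t ^ 1 / real d) + (?t ^ 2 / real d) / T"
      by (simp add: power2_eq_square distrib_left add_divide_distrib mult_ac)
    finally show "?t * loglog (real d) / real d \<le> (1 + ln T) * (?t ^ 1 / real d) + (?t ^ 2 / real d) / T" .
  qed
  also have "\<dots> = (1 + ln T) * divisor_moment 1 n + divisor_moment 2 n / T"
    unfolding divisor_moment_def by (simp only: sum.distrib sum_distrib_left sum_divide_distrib)
  finally show ?thesis .
qed

text \<open>From \<open>ln (T / t) \<le> T / t - 1\<close> with \<open>t = ln d\<close>. The truncation only raises the iterated logarithm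
above \<open>ln t\<close>.\<close>

lemma Psi_lower:
  assumes n: "n > 0" and T: "T > 0"
  shows "Psi n \<ge> ln T * divisor_moment 1 n - T * divisor_moment 0 n"
proof -
  have "ln T * divisor_moment 1 n - T * divisor_moment 0 n
     = (\<Sum>d | d dvd n. ln T * (ln (real d) ^ 1 / real d) - T * (ln (real d) ^ 0 / real d))"
    unfolding divisor_moment_def by (simp only: sum_subtractf sum_distrib_left)
  also have "\<dots> \<le> Psi n"
    unfolding Psi_def
  proof (rule sum_mono)
    fix d assume "d \<in> {d. d dvd n}"
    hence d: "d > 0" using n by (auto intro: dvd_pos_nat)
    let ?t = "ln (real d)"
    have "?t * ln T - T \<le> ?t * loglog (real d)"
    proof (cases "d = 1")
      case True
      thus ?thesis using T by simp
    next
      case False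
      hence t: "?t > 0" using d by simp
      have "ln ?t \<le> loglog (real d)"
      proof (cases "real d \<le> exp (exp 1)")
        case True
        hence "?t \<le> exp 1" using d by (metis exp_le_cancel_iff exp_ln of_nat_0_less_iff)
        hence "ln ?t \<le> 1" using t by (metis exp_le_cancel_iff exp_ln)
        thus ?thesis using True by (simp add: loglog_def)
      qed (simp add: loglog_def)
      moreover have "ln T - ln ?t \<le> T / ?t - 1"
        using ln_le_minus_one[of "T / ?t"] t T by (simp add: ln_div)
      ultimately have "ln T - T / ?t \<le> loglog (real d)" by simp
      hence "?t * (ln T - T / ?t) \<le> ?t * loglog (real d)" using t by (intro mult_left_mono) auto
      thus ?thesis using t by (simp add: right_diff_distrib)
    qed
    hence "(?t * ln T - T) / real d \<le> ?t * loglog (real d) / real d" by (intro divide_right_mono) auto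
    thus "ln T * (?t ^ 1 / real d) - T * (?t ^ 0 / real d) \<le> ?t * loglog (real d) / real d"
      by (simp add: diff_divide_distrib mult.commute)
  qed
  finally show ?thesis .
qed

lemma ln_over_antimono:
  fixes x y :: real
  assumes "exp 1 \<le> y" "y \<le> x"
  shows "ln x / x \<le> ln y / y"
proof -
  have y: "y > 0" using assms(1) exp_gt_zero[of "1::real"] by linarith
  have x: "x > 0" using y assms by linarith
  have ly: "ln y \<ge> 1" using assms(1) y by (simp add: ln_ge_iff)
  have "ln x = ln y + ln (x / y)" using x y by (simp add: ln_div)
  also have "ln (x / y) \<le> x / y - 1" using x y by (intro ln_le_minus_one) auto
  also have "x / y - 1 \<le> (x / y - 1) * ln y"
    using ly assms y mult_left_mono[of 1 "ln y" "x / y - 1"] by simp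
  finally have "ln x \<le> (x / y) * ln y" by (simp add: algebra_simps)
  thus ?thesis using x y by (simp add: field_simps)
qed

text \<open>Apply the previous lemma to square roots: \<open>(ln x)\<^sup>2 / x\<close> is four times the square of
\<open>ln (sqrt x) / sqrt x\<close>.\<close>

lemma ln_square_over_antimono:
  fixes x y :: real
  assumes "exp 2 \<le> y" "y \<le> x"
  shows "ln x ^ 2 / x \<le> ln y ^ 2 / y"
proof -
  have y: "y > 0" using assms(1) exp_gt_zero[of "2::real"] by linarith
  have x: "x > 0" using y assms by linarith
  have e: "ln z ^ 2 / z = 4 * (ln (sqrt z) / sqrt z) ^ 2" if "z > 0" for z :: real
    using that by (simp add: ln_sqrt power_divide)
  have "sqrt (exp 2) \<le> sqrt y" using assms by simp
  also have "sqrt (exp 2) = exp (1::real)" by (rule real_sqrt_unique) (simp_all flip: exp_double)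
  finally have sy: "exp 1 \<le> sqrt y" .
  have "ln (sqrt x) / sqrt x \<le> ln (sqrt y) / sqrt y"
    using sy assms by (intro ln_over_antimono) auto
  moreover have "sqrt x \<ge> 1" using sy assms real_sqrt_le_mono[of y x] one_le_exp_iff[of "1::real"] by linarith
  hence "0 \<le> ln (sqrt x) / sqrt x" by (intro divide_nonneg_nonneg) auto
  ultimately have "(ln (sqrt x) / sqrt x) ^ 2 \<le> (ln (sqrt y) / sqrt y) ^ 2" by (intro power_mono)
  thus ?thesis using e x y by simp
qed

text \<open>The product of these primes divides \<open>n\<close>, and each of them exceeds \<open>2\<^sup>J\<close>.\<close>

lemma card_large_prime_factors:
  assumes n: "n > 0" and le: "ln (real n) \<le> 2 ^ J"
  shows "real (card (prime_factors n - primes_le (2 ^ J))) * (real J * ln 2) \<le> 2 ^ J"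
proof -
  let ?L = "prime_factors n - primes_le (2 ^ J)"
  have L: "prime p" "p dvd n" "2 ^ J < p" if "p \<in> ?L" for p
    using that by (auto simp: primes_le_def)
  have "real (card ?L) * (real J * ln 2) = (\<Sum>p\<in>?L. real J * ln 2)" by simp
  also have "\<dots> \<le> (\<Sum>p\<in>?L. ln (real p))"
  proof (rule sum_mono)
    fix p assume p: "p \<in> ?L"
    have "real (2 ^ J) \<le> real p" using L(3)[OF p] unfolding of_nat_le_iff by simp
    hence "ln (real (2 ^ J)) \<le> ln (real p)" using L(3)[OF p] by (subst ln_le_cancel_iff) auto
    thus "real J * ln 2 \<le> ln (real p)" by (simp add: ln_realpow)
  qed
  also have "\<dots> = ln (\<Prod>p\<in>?L. real p)"
    using L prime_gt_0_nat by (intro ln_prod[symmetric]) auto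
  also have "\<dots> = ln (real (\<Prod>?L))" by simp
  also have "\<dots> \<le> ln (real n)"
  proof -
    have dvd: "\<Prod>?L dvd n" using L by (intro prod_primes_dvd) auto
    hence "\<Prod>?L \<le> n" using n by (intro dvd_imp_le)
    moreover have "\<Prod>?L > 0" using dvd n by (auto intro: dvd_pos_nat)
    ultimately show ?thesis by (subst ln_le_cancel_iff) (auto simp flip: of_nat_prod)
  qed
  also have "\<dots> \<le> 2 ^ J" by (rule le)
  finally show ?thesis .
qed

lemma sum_prime_factors_le:
  fixes f :: "nat \<Rightarrow> real"
  assumes f: "\<And>p. prime p \<Longrightarrow> f p \<ge> 0"
    and c: "\<And>p. prime p \<Longrightarrow> 2 ^ J < p \<Longrightarrow> f p \<le> c"
  shows "sum f (prime_factors n)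
      \<le> sum f (primes_le (2 ^ J)) + real (card (prime_factors n - primes_le (2 ^ J))) * c"
proof -
  let ?S = "primes_le (2 ^ J)" and ?A = "prime_factors n"
  have "sum f ?A = sum f (?A \<inter> ?S) + sum f (?A - ?S)"
    by (rule sum.Int_Diff) simp
  also have "sum f (?A \<inter> ?S) \<le> sum f ?S"
    by (intro sum_mono2) (auto intro!: f dest: primes_leD)
  also have "sum f (?A - ?S) \<le> (\<Sum>p\<in>?A - ?S. c)"
    by (intro sum_mono c) (auto simp: primes_le_def)
  finally show ?thesis by simp
qed

text \<open>The primes above \<open>2\<^sup>J\<close> contribute factors of at most \<open>1 + 1 / 2\<^sup>J\<close> each, and they are at most
\<open>2\<^sup>J / (J * ln 2)\<close> in number.\<close>

lemma divisor_moment_0_le: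
  assumes n: "n > 0" and le: "ln (real n) \<le> 2 ^ J" and J: "J \<ge> 1"
  shows "divisor_moment 0 n \<le> mertens_product J * exp (1 / (real J * ln 2))"
proof -
  let ?A = "prime_factors n" and ?S = "primes_le (2 ^ J)"
  let ?f = "\<lambda>p. 1 / (1 - 1 / real p)"
  have f1: "?f p \<ge> 1" if "prime p" for p
    using prime_ge_2_nat[OF that] by (simp add: field_simps)
  have f0: "?f p \<ge> 0" if "p \<in> ?A \<or> p \<in> ?S" for p
  proof -
    have "prime p" using that by (auto simp: primes_le_def)
    from order.trans[OF zero_le_one f1[OF this]] show ?thesis .
  qed
  have T: "real J * ln 2 > 0" using J by simp
  have "n = (\<Prod>p\<in>?A. p ^ multiplicity p n)" using n by (intro prime_factorization_nat)
  hence "divisor_moment 0 n = divisor_moment 0 (\<Prod>p\<in>?A. p ^ multiplicity p n)" by simp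
  also have "\<dots> = (\<Prod>p\<in>?A. exponent_moment 0 p (multiplicity p n))"
    by (rule divisor_moment_0_prod) auto
  also have "\<dots> \<le> (\<Prod>p\<in>?A. ?f p)"
    by (intro prod_mono conjI exponent_moment_0_le order.trans[OF zero_le_one exponent_moment_0_ge1]) auto
  also have "\<dots> = (\<Prod>p\<in>?A \<inter> ?S. ?f p) * (\<Prod>p\<in>?A - ?S. ?f p)"
    by (rule prod.Int_Diff) simp
  also have "\<dots> \<le> (\<Prod>p\<in>?S. ?f p) * (\<Prod>p\<in>?A - ?S. exp (1 / 2 ^ J))"
  proof (intro mult_mono)
    show "(\<Prod>p\<in>?A \<inter> ?S. ?f p) \<le> (\<Prod>p\<in>?S. ?f p)"
      using f1 by (intro prod_mono2) (force dest: primes_leD intro: order.trans[OF zero_le_one])+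
    show "(\<Prod>p\<in>?A - ?S. ?f p) \<le> (\<Prod>p\<in>?A - ?S. exp (1 / 2 ^ J))"
    proof (intro prod_mono conjI)
      fix p assume "p \<in> ?A - ?S"
      hence p: "prime p" "2 ^ J < p" by (auto simp: primes_le_def)
      show "0 \<le> ?f p" using f1[OF p(1)] by linarith
      have p2: "p \<ge> 2" using p prime_ge_2_nat by auto
      have "2 ^ J \<le> p - 1" using p by simp
      hence "real (2 ^ J) \<le> real (p - 1)" unfolding of_nat_le_iff .
      hence J1: "2 ^ J \<le> real p - 1" using p2 by (simp add: of_nat_diff)
      have "?f p = 1 + 1 / (real p - 1)" using p2 by (simp add: field_simps)
      also have "\<dots> \<le> 1 + 1 / 2 ^ J" using J1 p2 by (intro add_left_mono divide_left_mono) auto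
      also have "\<dots> \<le> exp (1 / 2 ^ J)" by (rule exp_ge_add_one_self)
      finally show "?f p \<le> exp (1 / 2 ^ J)" .
    qed
  qed (auto intro!: prod_nonneg f0)
  also have "(\<Prod>p\<in>?A - ?S. exp (1 / 2 ^ J)) = exp (real (card (?A - ?S)) * (1 / 2 ^ J))"
    by (simp only: prod_constant exp_of_nat_mult)
  finally have "divisor_moment 0 n \<le> (\<Prod>p\<in>?S. ?f p) * exp (real (card (?A - ?S)) * (1 / 2 ^ J))" .
  also have "\<dots> \<le> (\<Prod>p\<in>?S. ?f p) * exp (1 / (real J * ln 2))"
  proof (intro mult_left_mono)
    show "exp (real (card (?A - ?S)) * (1 / 2 ^ J)) \<le> exp (1 / (real J * ln 2))"
      using card_large_prime_factors[OF n le] T by (simp add: field_simps)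
    show "(\<Prod>p\<in>?S. ?f p) \<ge> 0" by (auto intro!: prod_nonneg f0)
  qed
  finally show ?thesis by (simp add: mertens_product_def)
qed

text \<open>The primes up to \<open>2\<^sup>J\<close> give the main terms by Mertens' first theorem. For larger primes,
\<open>ln p / p\<close> and \<open>(ln p)\<^sup>2 / p\<close> are at most their values at \<open>2\<^sup>J\<close>, and the bound on the number of these
primes leaves \<open>O(1)\<close> and \<open>O(J)\<close>. The condition \<open>J \<ge> 4\<close> puts \<open>2\<^sup>J\<close> above \<open>e\<^sup>2\<close>, where both functions
decrease.\<close>

lemma sum_ln_prime_factors_le:
  "\<exists>C\<ge>0. \<forall>n J. n > 0 \<longrightarrow> ln (real n) \<le> 2 ^ J \<longrightarrow> J \<ge> 4 \<longrightarrow>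
     (\<Sum>p\<in>prime_factors n. ln (real p) / (real p - 1)) \<le> real J * ln 2 + C \<and>
     (\<Sum>p\<in>prime_factors n. ln (real p) ^ 2 / real p) \<le> (real J * ln 2) * (real J * ln 2 + C)"
proof -
  obtain C where C: "\<And>n. \<bar>(\<Sum>p\<in>primes_le (2 ^ n). ln (real p) / real p) - real n * ln 2\<bar> \<le> C"
    using mertens_first_dyadic by blast
  obtain K where K: "\<And>A. finite A \<Longrightarrow> (\<Sum>p\<in>A. ln (real p) / real p ^ 2) \<le> K"
    using sum_ln_over_square_bounded by blast
  have C0: "C \<ge> 0" using C[of 0] by linarith
  have K0: "K \<ge> 0" using K[of "{}"] by simp
  have main: "(\<Sum>p\<in>prime_factors n. ln (real p) / (real p - 1)) \<le> real J * ln 2 + (C + 2 * K + 2) \<and>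
     (\<Sum>p\<in>prime_factors n. ln (real p) ^ 2 / real p) \<le> (real J * ln 2) * (real J * ln 2 + (C + 2 * K + 2))"
    if n: "n > 0" and le: "ln (real n) \<le> 2 ^ J" and J: "J \<ge> 4" for n J
  proof -
    define T where "T = real J * ln 2"
    define r where "r = real (card (prime_factors n - primes_le (2 ^ J)))"
    have "real J * ln 2 \<ge> 4 * (1/2)" using J ln2_ge_half by (intro mult_mono) auto
    hence T2: "T \<ge> 2" by (simp add: T_def)
    have r: "r * T \<le> 2 ^ J" using card_large_prime_factors[OF n le] by (simp add: r_def T_def)
    have r0: "r \<ge> 0" by (simp add: r_def)
    have lnJ: "ln (2 ^ J :: real) = T" by (simp add: T_def ln_realpow)
    have "exp 2 \<le> exp T" using T2 by simp
    also have "exp T = 2 ^ J" using lnJ exp_ln[of "2 ^ J :: real"] by simp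
    finally have e2: "exp 2 \<le> (2 ^ J :: real)" .
    have e1: "exp 1 \<le> (2 ^ J :: real)" using e2 exp_le_cancel_iff[of 1 "2::real"] by linarith
    have A: "(\<Sum>p\<in>primes_le (2 ^ J). ln (real p) / real p) \<le> T + C"
      using C[of J] by (simp add: T_def abs_le_iff)
    have big: "2 ^ J \<le> real p" if "2 ^ J < p" for p
    proof -
      have "real (2 ^ J) \<le> real p" using that unfolding of_nat_le_iff by simp
      thus ?thesis by simp
    qed
    have "(\<Sum>p\<in>prime_factors n. ln (real p) / (real p - 1))
       \<le> (\<Sum>p\<in>primes_le (2 ^ J). ln (real p) / (real p - 1)) + r * (2 * (T / 2 ^ J))"
      unfolding r_def
    proof (rule sum_prime_factors_le)
      fix p :: nat assume p: "prime p"
      hence p2: "p \<ge> 2" by (rule prime_ge_2_nat)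
      thus "0 \<le> ln (real p) / (real p - 1)" by (intro divide_nonneg_nonneg) auto
      assume "2 ^ J < p"
      hence small: "ln (real p) / real p \<le> T / 2 ^ J"
        using ln_over_antimono[OF e1 big] lnJ by simp
      have "ln (real p) / (real p - 1) \<le> ln (real p) / (real p / 2)"
        using p2 by (intro divide_left_mono) auto
      also have "\<dots> = 2 * (ln (real p) / real p)" by simp
      also have "\<dots> \<le> 2 * (T / 2 ^ J)" using small by (intro mult_left_mono) auto
      finally show "ln (real p) / (real p - 1) \<le> 2 * (T / 2 ^ J)" .
    qed
    also have "r * (2 * (T / 2 ^ J)) \<le> 2" using r by (simp add: field_simps)
    also have "(\<Sum>p\<in>primes_le (2 ^ J). ln (real p) / (real p - 1))
        \<le> (\<Sum>p\<in>primes_le (2 ^ J). ln (real p) / real p + 2 * (ln (real p) / real p ^ 2))"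
      by (intro sum_mono ln_over_pred_le) (auto dest: primes_leD)
    also have "\<dots> = (\<Sum>p\<in>primes_le (2 ^ J). ln (real p) / real p) + 2 * (\<Sum>p\<in>primes_le (2 ^ J). ln (real p) / real p ^ 2)"
      by (simp only: sum.distrib sum_distrib_left)
    also have "\<dots> \<le> (T + C) + 2 * K" using A K[of "primes_le (2 ^ J)"] by simp
    finally have 1: "(\<Sum>p\<in>prime_factors n. ln (real p) / (real p - 1)) \<le> T + (C + 2 * K + 2)" by simp
    have "(\<Sum>p\<in>prime_factors n. ln (real p) ^ 2 / real p)
       \<le> (\<Sum>p\<in>primes_le (2 ^ J). ln (real p) ^ 2 / real p) + r * (T ^ 2 / 2 ^ J)"
      unfolding r_def
    proof (rule sum_prime_factors_le)
      fix p :: nat assume p: "prime p" "2 ^ J < p"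
      show "ln (real p) ^ 2 / real p \<le> T ^ 2 / 2 ^ J"
        using ln_square_over_antimono[OF e2 big[OF p(2)]] lnJ by simp
    qed simp
    also have "(\<Sum>p\<in>primes_le (2 ^ J). ln (real p) ^ 2 / real p) \<le> (\<Sum>p\<in>primes_le (2 ^ J). T * (ln (real p) / real p))"
    proof (rule sum_mono)
      fix p assume "p \<in> primes_le (2 ^ J)"
      hence p: "p \<le> 2 ^ J" "p \<ge> 2" by (auto dest: primes_leD)
      have "real p \<le> real (2 ^ J)" using p unfolding of_nat_le_iff by simp
      hence "ln (real p) \<le> ln (real (2 ^ J))" using p by (subst ln_le_cancel_iff) auto
      hence "ln (real p) \<le> T" using lnJ by simp
      hence "ln (real p) * (ln (real p) / real p) \<le> T * (ln (real p) / real p)"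
        using p by (intro mult_right_mono) auto
      thus "ln (real p) ^ 2 / real p \<le> T * (ln (real p) / real p)" by (simp add: power2_eq_square)
    qed
    also have "\<dots> = T * (\<Sum>p\<in>primes_le (2 ^ J). ln (real p) / real p)" by (simp only: sum_distrib_left)
    also have "\<dots> \<le> T * (T + C)" using A T2 by (intro mult_left_mono) auto
    also have "r * (T ^ 2 / 2 ^ J) = (r * T) / 2 ^ J * T" by (simp add: power2_eq_square)
    also have "\<dots> \<le> 1 * T" using r T2 by (intro mult_right_mono) auto
    finally have "(\<Sum>p\<in>prime_factors n. ln (real p) ^ 2 / real p) \<le> T * (T + (C + 1))" by (simp add: algebra_simps)
    also have "\<dots> \<le> T * (T + (C + 2 * K + 2))" using T2 K0 by (intro mult_left_mono) auto
    finally show ?thesis using 1 by (simp add: T_def)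
  qed
  show ?thesis
    by (rule exI[of _ "C + 2 * K + 2"]) (use main C0 K0 in auto)
qed

lemma Psi_le_dyadic:
  "\<exists>C\<ge>0. \<forall>n J. n > 0 \<longrightarrow> ln (real n) \<le> 2 ^ J \<longrightarrow> J \<ge> 4 \<longrightarrow> (\<forall>T. T = real J * ln 2 \<longrightarrow>
     Psi n \<le> mertens_product J * exp (1 / T) * ((1 + ln T) * (T + C) + ((T + C)\<^sup>2 + 6 * (T * (T + C))) / T))"
proof -
  obtain C where C0: "C \<ge> 0" and C: "\<forall>n J. n > 0 \<longrightarrow> ln (real n) \<le> 2 ^ J \<longrightarrow> J \<ge> 4 \<longrightarrow>
     (\<Sum>p\<in>prime_factors n. ln (real p) / (real p - 1)) \<le> real J * ln 2 + C \<and>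
     (\<Sum>p\<in>prime_factors n. ln (real p) ^ 2 / real p) \<le> (real J * ln 2) * (real J * ln 2 + C)"
    using sum_ln_prime_factors_le by (elim exE conjE)
  have "Psi n \<le> mertens_product J * exp (1 / T) * ((1 + ln T) * (T + C) + ((T + C)\<^sup>2 + 6 * (T * (T + C))) / T)"
    if n: "n > 0" and le: "ln (real n) \<le> 2 ^ J" and J: "J \<ge> 4" and T: "T = real J * ln 2" for n J T
  proof -
    let ?A = "prime_factors n"
    let ?k = "\<lambda>p. multiplicity p n"
    let ?a = "\<Sum>p\<in>?A. ln (real p) * mean_exponent p (?k p)"
    let ?b = "\<Sum>p\<in>?A. ln (real p) ^ 2 * (exponent_moment 2 p (?k p) / exponent_moment 0 p (?k p))"
    have "real J * ln 2 \<ge> 4 * (1/2)" using J ln2_ge_half by (intro mult_mono) auto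
    hence T2: "T \<ge> 2" by (simp add: T)
    have neq: "(\<Prod>p\<in>?A. p ^ ?k p) = n" using n by (intro prime_factorization_nat[symmetric])
    have gm: "mean_exponent p k \<ge> 0" for p k
      by (auto simp: mean_exponent_def exponent_moment_def intro!: divide_nonneg_nonneg sum_nonneg)
    have lnp: "ln (real p) \<ge> 0" if "p \<in> ?A" for p
      using that by (auto dest!: in_prime_factors_imp_prime prime_ge_1_nat)
    have a0: "?a \<ge> 0" using gm lnp by (intro sum_nonneg mult_nonneg_nonneg)
    have "?a \<le> (\<Sum>p\<in>?A. ln (real p) * (1 / (real p - 1)))"
      using lnp by (intro sum_mono mult_left_mono mean_exponent_le) auto
    also have "\<dots> \<le> T + C" using C n le J by (simp add: T)
    finally have a: "?a \<le> T + C" .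
    have "?b \<le> (\<Sum>p\<in>?A. ln (real p) ^ 2 * (6 / real p))"
      by (intro sum_mono mult_left_mono exponent_moment_2_le) auto
    also have "\<dots> = 6 * (\<Sum>p\<in>?A. ln (real p) ^ 2 / real p)" by (simp add: sum_distrib_left mult.commute)
    also have "\<dots> \<le> 6 * (T * (T + C))" using C n le J by (simp add: T)
    finally have b: "?b \<le> 6 * (T * (T + C))" .
    have m0: "divisor_moment 0 n \<ge> 0" by (simp add: divisor_moment_def sum_nonneg)
    have "divisor_moment 1 (\<Prod>p\<in>?A. p ^ ?k p) = divisor_moment 0 (\<Prod>p\<in>?A. p ^ ?k p) * ?a"
      by (rule divisor_moment_1_prod) auto
    hence m1: "divisor_moment 1 n = divisor_moment 0 n * ?a" unfolding neq .
    have "divisor_moment 2 (\<Prod>p\<in>?A. p ^ ?k p) \<le> divisor_moment 0 (\<Prod>p\<in>?A. p ^ ?k p) * (?a\<^sup>2 + ?b)"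
      by (rule divisor_moment_2_prod_le) auto
    hence "divisor_moment 2 n \<le> divisor_moment 0 n * (?a\<^sup>2 + ?b)" unfolding neq .
    also have "\<dots> \<le> divisor_moment 0 n * ((T + C)\<^sup>2 + 6 * (T * (T + C)))"
      using a a0 b m0 by (intro mult_left_mono add_mono power_mono)
    finally have m2: "divisor_moment 2 n \<le> divisor_moment 0 n * ((T + C)\<^sup>2 + 6 * (T * (T + C)))" .
    let ?W = "(1 + ln T) * (T + C) + ((T + C)\<^sup>2 + 6 * (T * (T + C))) / T"
    have W: "?W \<ge> 0" using T2 C0 by (intro add_nonneg_nonneg mult_nonneg_nonneg divide_nonneg_nonneg) auto
    have "Psi n \<le> (1 + ln T) * divisor_moment 1 n + divisor_moment 2 n / T"
      using n T2 by (intro Psi_upper) auto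
    also have "\<dots> \<le> (1 + ln T) * (divisor_moment 0 n * (T + C)) + divisor_moment 0 n * ((T + C)\<^sup>2 + 6 * (T * (T + C))) / T"
      unfolding m1 using T2 a m0 m2 by (intro add_mono mult_left_mono divide_right_mono) auto
    also have "\<dots> = divisor_moment 0 n * ?W" by (simp add: algebra_simps)
    also have "\<dots> \<le> (mertens_product J * exp (1 / T)) * ?W"
      using divisor_moment_0_le[OF n le] J W by (intro mult_right_mono) (auto simp: T)
    finally show ?thesis .
  qed
  thus ?thesis using C0 by blast
qed

section \<open>Numbers that attain the bound\<close>

text \<open>The exponent must tend to infinity with \<open>j\<close>, fast enough for the truncated Euler factors to
multiply up to the full product, and slowly enough not to disturb \<open>ln (ln n)\<close>.\<close>

definition extremal :: "nat \<Rightarrow> nat" where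
  "extremal j = (\<Prod>p\<in>primes_le (2 ^ j). p ^ (2 * j))"

lemma extremal_pos: "extremal j > 0"
  unfolding extremal_def by (intro prod_pos ballI) (auto dest!: primes_leD)

lemma extremal_ge:
  assumes "j \<ge> 1"
  shows "2 ^ (2 * j) \<le> extremal j"
proof (rule dvd_imp_le[OF _ extremal_pos])
  have "(2::nat) \<le> 2 ^ j" using assms by (cases j) auto
  hence "2 \<in> primes_le (2 ^ j)" by (simp add: primes_le_def)
  thus "2 ^ (2 * j) dvd extremal j" unfolding extremal_def by (intro dvd_prodI) auto
qed

lemma ln_extremal_le: "ln (real (extremal j)) \<le> real j * 2 ^ (j + 2)"
proof -
  have "ln (real (extremal j)) = ln (\<Prod>p\<in>primes_le (2 ^ j). real p ^ (2 * j))"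
    by (simp add: extremal_def)
  also have "\<dots> = (\<Sum>p\<in>primes_le (2 ^ j). ln (real p ^ (2 * j)))"
    by (intro ln_prod) (auto dest!: primes_leD)
  also have "\<dots> = (\<Sum>p\<in>primes_le (2 ^ j). real (2 * j) * ln (real p))"
    by (intro sum.cong refl) (auto dest!: primes_leD simp: ln_realpow)
  also have "\<dots> = 2 * real j * (\<Sum>p\<in>primes_le (2 ^ j). ln (real p))"
    by (simp add: sum_distrib_left)
  also have "\<dots> \<le> 2 * real j * (2 ^ Suc j * ln 2)"
    by (intro mult_left_mono chebyshev_theta_le) auto
  also have "\<dots> \<le> 2 * real j * (2 ^ Suc j * 1)"
    using ln_le_minus_one[of "2::real"] by (intro mult_left_mono) auto
  finally show ?thesis by simp
qed

text \<open>Truncation at exponent \<open>2 * j\<close> costs each factor at most \<open>1 - 1 / 2 ^ (2 * j)\<close>. There are at most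
\<open>2 ^ j\<close> of them, so Bernoulli's inequality bounds the total loss.\<close>

lemma divisor_moment_0_extremal_ge:
  assumes j: "j \<ge> 1"
  shows "divisor_moment 0 (extremal j) \<ge> mertens_product j * (1 - 1 / 2 ^ j)"
proof -
  let ?S = "primes_le (2 ^ j)"
  let ?e = "1 - 1 / 2 ^ (2 * j) :: real"
  have e0: "?e \<ge> 0" by simp
  have factor: "1 / (1 - 1 / real p) * ?e \<le> exponent_moment 0 p (2 * j)" "1 / (1 - 1 / real p) \<ge> 0"
    if "p \<in> ?S" for p
  proof -
    have p: "real p \<ge> 2" using primes_leD[OF that] by auto
    have "(1 / real p) ^ Suc (2 * j) \<le> (1 / 2) ^ Suc (2 * j)"
      using p by (intro power_mono) (auto simp: field_simps)
    also have "\<dots> \<le> (1 / 2) ^ (2 * j)" by (intro power_decreasing) auto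
    finally have "?e \<le> 1 - (1 / real p) ^ Suc (2 * j)" by (simp add: power_one_over)
    also have "\<dots> = (1 - 1 / real p) * exponent_moment 0 p (2 * j)"
      using sum_gp_basic[of "1 / real p" "2 * j"] by (simp add: exponent_moment_def)
    finally show "1 / (1 - 1 / real p) * ?e \<le> exponent_moment 0 p (2 * j)"
      using p by (simp add: field_simps)
    show "1 / (1 - 1 / real p) \<ge> 0" using p by simp
  qed
  have "card ?S \<le> card {1..2 ^ j :: nat}"
    by (intro card_mono) (auto dest!: primes_leD)
  hence "card ?S \<le> 2 ^ j" by simp
  hence "real (card ?S) \<le> real (2 ^ j)" unfolding of_nat_le_iff .
  hence "real (card ?S) * (1 / 2 ^ (2 * j)) \<le> 2 ^ j * (1 / 2 ^ (2 * j))"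
    by (intro mult_right_mono) auto
  also have "\<dots> = 1 / 2 ^ j" by (simp add: mult_2 power_add)
  finally have "1 - 1 / 2 ^ j \<le> 1 + real (card ?S) * (- (1 / 2 ^ (2 * j)))" by simp
  also have "\<dots> \<le> (1 + (- (1 / 2 ^ (2 * j)))) ^ card ?S"
    by (intro Bernoulli_inequality) simp
  finally have bern: "1 - 1 / 2 ^ j \<le> ?e ^ card ?S" by simp
  have "mertens_product j * (1 - 1 / 2 ^ j) \<le> mertens_product j * ?e ^ card ?S"
    using bern factor(2) unfolding mertens_product_def by (intro mult_left_mono prod_nonneg) auto
  also have "\<dots> = (\<Prod>p\<in>?S. 1 / (1 - 1 / real p) * ?e)"
    unfolding mertens_product_def prod.distrib prod_constant ..
  also have "\<dots> \<le> (\<Prod>p\<in>?S. exponent_moment 0 p (2 * j))"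
    using factor e0 by (intro prod_mono conjI mult_nonneg_nonneg) auto
  also have "\<dots> = divisor_moment 0 (extremal j)"
    unfolding extremal_def by (rule divisor_moment_0_prod[symmetric]) (auto dest: primes_leD)
  finally show ?thesis .
qed

lemma Psi_extremal_ge:
  "\<exists>C\<ge>0. \<forall>j. \<forall>T. T = real j * ln 2 \<longrightarrow> T \<ge> 1 \<longrightarrow> (T - C) * ln T - T \<ge> 0 \<longrightarrow>
     Psi (extremal j) \<ge> mertens_product j * (1 - 1 / 2 ^ j) * ((T - C) * ln T - T)"
proof -
  obtain C where C: "\<And>n. \<bar>(\<Sum>p\<in>primes_le (2 ^ n). ln (real p) / real p) - real n * ln 2\<bar> \<le> C"
    using mertens_first_dyadic by blast
  obtain K where K: "\<And>A. finite A \<Longrightarrow> (\<Sum>p\<in>A. ln (real p) / real p ^ 2) \<le> K"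
    using sum_ln_over_square_bounded by blast
  have C0: "C \<ge> 0" using C[of 0] by linarith
  have K0: "K \<ge> 0" using K[of "{}"] by simp
  have "Psi (extremal j) \<ge> mertens_product j * (1 - 1 / 2 ^ j) * ((T - (C + K)) * ln T - T)"
    if T: "T = real j * ln 2" and T1: "T \<ge> 1" and nonneg: "(T - (C + K)) * ln T - T \<ge> 0" for j T
  proof -
    let ?S = "primes_le (2 ^ j)"
    have j: "j \<ge> 1" using T T1 by (cases j) auto
    let ?a = "\<Sum>p\<in>?S. ln (real p) * mean_exponent p (2 * j)"
    have "T - (C + K) \<le> (\<Sum>p\<in>?S. ln (real p) / real p) - (\<Sum>p\<in>?S. ln (real p) / real p ^ 2)"
      using C[of j] K[of ?S] by (simp add: T abs_le_iff)
    also have "\<dots> = (\<Sum>p\<in>?S. ln (real p) * (1 / real p - 1 / real p ^ 2))"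
      by (simp add: sum_subtractf right_diff_distrib)
    also have "\<dots> \<le> ?a"
      using j by (intro sum_mono mult_left_mono mean_exponent_ge) (auto dest!: primes_leD)
    finally have a: "T - (C + K) \<le> ?a" .
    have m1: "divisor_moment 1 (extremal j) = divisor_moment 0 (extremal j) * ?a"
      unfolding extremal_def by (rule divisor_moment_1_prod) (auto dest: primes_leD)
    have m0: "divisor_moment 0 (extremal j) \<ge> 0" by (simp add: divisor_moment_def sum_nonneg)
    have "mertens_product j * (1 - 1 / 2 ^ j) * ((T - (C + K)) * ln T - T)
        \<le> divisor_moment 0 (extremal j) * ((T - (C + K)) * ln T - T)"
      using divisor_moment_0_extremal_ge[OF j] nonneg by (intro mult_right_mono)
    also have "\<dots> \<le> divisor_moment 0 (extremal j) * (?a * ln T - T)"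
      using a T1 m0 by (intro mult_left_mono diff_right_mono mult_right_mono) auto
    also have "\<dots> = ln T * divisor_moment 1 (extremal j) - T * divisor_moment 0 (extremal j)"
      unfolding m1 by (simp add: algebra_simps)
    also have "\<dots> \<le> Psi (extremal j)" using T1 extremal_pos by (intro Psi_lower) auto
    finally show ?thesis .
  qed
  thus ?thesis using C0 K0 by (intro exI[of _ "C + K"]) auto
qed

lemma eventually_loglog: "\<forall>\<^sub>F x in at_top. loglog x = ln (ln x)"
  using eventually_gt_at_top[of "exp (exp 1)"] by eventually_elim (simp add: loglog_def)

lemma eventually_logloglog: "\<forall>\<^sub>F x in at_top. logloglog x = ln (ln (ln x))"
  using eventually_gt_at_top[of "exp (exp (exp 1))"] by eventually_elim (simp add: logloglog_def)

text \<open>Sending \<open>n\<close> to the least \<open>J\<close> with \<open>ln n \<le> 2 ^ J\<close> bounds the quotient by a sequence in \<open>J\<close> alone. Since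
\<open>ln (ln n)\<close> and \<open>T = J * ln 2\<close> differ by at most \<open>ln 2\<close>, that sequence still tends to \<open>e\<^sup>\<gamma>\<close>.\<close>

lemma limsup_ratio_le:
  "limsup (\<lambda>n. ereal (Psi n / ((loglog (real n))\<^sup>2 * logloglog (real n)))) \<le> ereal (exp euler_mascheroni)"
proof -
  obtain C where C0: "C \<ge> 0" and C: "\<forall>n J. n > 0 \<longrightarrow> ln (real n) \<le> 2 ^ J \<longrightarrow> J \<ge> 4 \<longrightarrow> (\<forall>T. T = real J * ln 2 \<longrightarrow>
     Psi n \<le> mertens_product J * exp (1 / T) * ((1 + ln T) * (T + C) + ((T + C)\<^sup>2 + 6 * (T * (T + C))) / T))"
    using Psi_le_dyadic by (elim exE conjE)
  define W where "W T = exp (1 / T) * ((1 + ln T) * (T + C) + ((T + C)\<^sup>2 + 6 * (T * (T + C))) / T)" for T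
  define D where "D T = (T - ln 2)\<^sup>2 * ln (T - ln 2)" for T :: real
  \<comment> \<open>\<open>W\<close> and \<open>mertens_product\<close> bound the numerator, and \<open>D\<close> is a lower bound for the denominator.\<close>
  define U where "U J = mertens_product J * W (real J * ln 2) / D (real J * ln 2)" for J
  define J where "J n = nat \<lceil>log 2 (ln (real n))\<rceil>" for n
  have "((\<lambda>T. T * W T / D T) \<longlongrightarrow> 1) at_top"
    unfolding W_def D_def by real_asymp
  moreover have "filterlim (\<lambda>J. real J * ln 2) at_top sequentially" by real_asymp
  ultimately have "(\<lambda>J. (real J * ln 2) * W (real J * ln 2) / D (real J * ln 2)) \<longlonglongrightarrow> 1"
    by (rule filterlim_compose)
  from tendsto_mult[OF mertens_third_dyadic this]
  have "(\<lambda>J. mertens_product J / (real J * ln 2) * ((real J * ln 2) * W (real J * ln 2) / D (real J * ln 2)))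
     \<longlonglongrightarrow> exp euler_mascheroni" by simp
  moreover have "\<forall>\<^sub>F J in sequentially. mertens_product J / (real J * ln 2) * ((real J * ln 2) * W (real J * ln 2) / D (real J * ln 2)) = U J"
    using eventually_gt_at_top[of 0] by eventually_elim (simp add: U_def)
  ultimately have U: "U \<longlonglongrightarrow> exp euler_mascheroni" by (rule Lim_transform_eventually)
  have J: "filterlim J at_top sequentially" unfolding J_def by real_asymp
  have UJ: "(\<lambda>n. U (J n)) \<longlonglongrightarrow> exp euler_mascheroni" by (rule filterlim_compose[OF U J])
  have ev: "\<forall>\<^sub>F n in sequentially. Psi n / ((loglog (real n))\<^sup>2 * logloglog (real n)) \<le> U (J n)"
  proof -
    have lim: "filterlim real at_top sequentially" by (rule filterlim_real_sequentially)
    have "\<forall>\<^sub>F n in sequentially. J n \<ge> 6" using J by (auto simp: filterlim_at_top)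
    moreover have "\<forall>\<^sub>F n in sequentially. log 2 (ln (real n)) > 0" by real_asymp
    moreover have "\<forall>\<^sub>F n in sequentially. ln (real n) > 0" by real_asymp
    moreover have "\<forall>\<^sub>F n in sequentially. loglog (real n) = ln (ln (real n))"
      using eventually_loglog lim by (rule eventually_compose_filterlim)
    moreover have "\<forall>\<^sub>F n in sequentially. logloglog (real n) = ln (ln (ln (real n)))"
      using eventually_logloglog lim by (rule eventually_compose_filterlim)
    moreover have "\<forall>\<^sub>F n in sequentially. (n::nat) > 0" by (rule eventually_gt_at_top)
    ultimately show ?thesis
    proof eventually_elim
      case (elim n)
      define T where "T = real (J n) * ln 2"
      have up: "log 2 (ln (real n)) \<le> real (J n)" using elim(2) by (simp add: J_def)
      have lo: "real (J n) - 1 < log 2 (ln (real n))" using elim(2) unfolding J_def by linarith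
      have le: "ln (real n) \<le> 2 ^ J n"
        using up elim(3) by (simp add: log_le_iff powr_realpow)
      have "T - ln 2 = (real (J n) - 1) * ln 2" by (simp add: T_def algebra_simps)
      also have "\<dots> \<le> log 2 (ln (real n)) * ln 2" using lo by (intro mult_right_mono) auto
      also have "\<dots> = ln (ln (real n))" by (simp add: log_def)
      finally have lln: "T - ln 2 \<le> ln (ln (real n))" .
      \<comment> \<open>\<open>J \<ge> 6\<close> makes the logarithm in \<open>D T\<close> positive, so that \<open>D\<close> may replace the denominator.\<close>
      have "5 * (1/2) \<le> (real (J n) - 1) * ln 2" using elim(1) ln2_ge_half by (intro mult_mono) auto
      hence T1: "T - ln 2 > 1" by (simp add: T_def algebra_simps)
      have Dpos: "D T > 0" using T1 by (simp add: D_def)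
      have W: "W T \<ge> 0" unfolding W_def using T1 C0 ln2_ge_half by (intro mult_nonneg_nonneg add_nonneg_nonneg divide_nonneg_nonneg) auto
      have den: "D T \<le> (loglog (real n))\<^sup>2 * logloglog (real n)"
        unfolding D_def elim(4,5) using lln T1 by (intro mult_mono power_mono) auto
      have "Psi n \<le> mertens_product (J n) * W T"
        using C elim le T_def by (auto simp: W_def mult.assoc)
      moreover have "0 \<le> mertens_product (J n) * W T"
        using W unfolding mertens_product_def
        by (intro mult_nonneg_nonneg prod_nonneg) (auto dest!: primes_leD)
      ultimately have "Psi n / ((loglog (real n))\<^sup>2 * logloglog (real n)) \<le> mertens_product (J n) * W T / D T"
        using den Dpos by (intro frac_le) auto
      thus ?case by (simp add: U_def T_def)
    qed
  qed
  have "limsup (\<lambda>n. ereal (Psi n / ((loglog (real n))\<^sup>2 * logloglog (real n)))) \<le> limsup (\<lambda>n. ereal (U (J n)))"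
    by (rule Limsup_mono) (use ev in simp)
  also have "\<dots> = ereal (exp euler_mascheroni)"
    by (rule lim_imp_Limsup[OF trivial_limit_sequentially tendsto_ereal[OF UJ]])
  finally show ?thesis .
qed

lemma limsup_ratio_ge:
  "limsup (\<lambda>n. ereal (Psi n / ((loglog (real n))\<^sup>2 * logloglog (real n)))) \<ge> ereal (exp euler_mascheroni)"
proof (rule ccontr)
  let ?f = "\<lambda>n. Psi n / ((loglog (real n))\<^sup>2 * logloglog (real n))"
  assume "\<not> ?thesis"
  hence lt: "limsup (\<lambda>n. ereal (?f n)) < ereal (exp euler_mascheroni)" by simp
  from ereal_dense2[OF lt] obtain c where c: "limsup (\<lambda>n. ereal (?f n)) < ereal c" "c < exp euler_mascheroni"
    unfolding less_ereal.simps(1) by (elim exE conjE)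
  have small: "\<forall>\<^sub>F n in sequentially. ?f n < c" using Limsup_lessD[OF c(1)] by simp
  obtain C where C0: "C \<ge> 0" and C: "\<forall>j. \<forall>T. T = real j * ln 2 \<longrightarrow> T \<ge> 1 \<longrightarrow> (T - C) * ln T - T \<ge> 0 \<longrightarrow>
     Psi (extremal j) \<ge> mertens_product j * (1 - 1 / 2 ^ j) * ((T - C) * ln T - T)"
    using Psi_extremal_ge by (elim exE conjE)
  define T where "T j = real j * ln 2" for j
  \<comment> \<open>The logarithm of the bound for \<open>ln n\<close> that Chebyshev's estimate gives.\<close>
  define V where "V j = ln (real j * 2 ^ (j + 2))" for j
  define Y where "Y j = (1 - 1 / 2 ^ j) * ((T j - C) * ln (T j) - T j)" for j
  define L where "L j = mertens_product j * Y j / ((V j)\<^sup>2 * ln (V j))" for j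
  have Vlim: "\<forall>\<^sub>F j in sequentially. V j = ln (real j) + (real j + 2) * ln 2"
    using eventually_gt_at_top[of 0] by eventually_elim (simp add: V_def ln_mult ln_realpow flip: power_Suc)
  have "(\<lambda>j. T j * Y j / ((ln (real j) + (real j + 2) * ln 2)\<^sup>2 * ln (ln (real j) + (real j + 2) * ln 2))) \<longlonglongrightarrow> 1"
    unfolding T_def Y_def by real_asymp (simp add: power2_eq_square field_simps)
  moreover have "\<forall>\<^sub>F j in sequentially. T j * Y j / ((ln (real j) + (real j + 2) * ln 2)\<^sup>2 * ln (ln (real j) + (real j + 2) * ln 2))
      = T j * Y j / ((V j)\<^sup>2 * ln (V j))"
    using Vlim by eventually_elim simp
  ultimately have "(\<lambda>j. T j * Y j / ((V j)\<^sup>2 * ln (V j))) \<longlonglongrightarrow> 1" by (rule Lim_transform_eventually)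
  from tendsto_mult[OF mertens_third_dyadic this]
  have "(\<lambda>j. mertens_product j / (real j * ln 2) * (T j * Y j / ((V j)\<^sup>2 * ln (V j)))) \<longlonglongrightarrow> exp euler_mascheroni" by simp
  moreover have "\<forall>\<^sub>F j in sequentially. mertens_product j / (real j * ln 2) * (T j * Y j / ((V j)\<^sup>2 * ln (V j))) = L j"
    using eventually_gt_at_top[of 0] by eventually_elim (simp add: L_def T_def)
  ultimately have L: "L \<longlonglongrightarrow> exp euler_mascheroni" by (rule Lim_transform_eventually)
  have N: "filterlim extremal at_top sequentially"
  proof (rule filterlim_at_top_mono)
    show "filterlim (\<lambda>j::nat. j) at_top sequentially" by (rule filterlim_ident)
    have "j \<le> extremal j" if "j \<ge> 1" for j
    proof -
      have "j < 2 ^ j" by (rule less_exp)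
      also have "(2::nat) ^ j \<le> 2 ^ (2 * j)" by (intro power_increasing) auto
      also have "\<dots> \<le> extremal j" by (rule extremal_ge[OF that])
      finally show ?thesis by simp
    qed
    thus "\<forall>\<^sub>F j in sequentially. j \<le> extremal j" by (rule eventually_sequentiallyI)
  qed
  have lim: "filterlim (\<lambda>j. real (extremal j)) at_top sequentially"
    by (rule filterlim_compose[OF filterlim_real_sequentially N])
  have "\<forall>\<^sub>F j in sequentially. L j > c" using order_tendstoD(1)[OF L c(2)] .
  moreover have "\<forall>\<^sub>F j in sequentially. ?f (extremal j) < c"
    using small N by (rule eventually_compose_filterlim)
  moreover have "\<forall>\<^sub>F j in sequentially. loglog (real (extremal j)) = ln (ln (real (extremal j)))"
    using eventually_loglog lim by (rule eventually_compose_filterlim)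
  moreover have "\<forall>\<^sub>F j in sequentially. logloglog (real (extremal j)) = ln (ln (ln (real (extremal j))))"
    using eventually_logloglog lim by (rule eventually_compose_filterlim)
  moreover have "\<forall>\<^sub>F x in at_top. ln (ln (x::real)) > 1 \<and> ln x > 0"
    by (intro eventually_conj; real_asymp)
  hence "\<forall>\<^sub>F j in sequentially. ln (ln (real (extremal j))) > 1 \<and> ln (real (extremal j)) > 0"
    using lim by (rule eventually_compose_filterlim)
  moreover have "\<forall>\<^sub>F j in sequentially. T j \<ge> 1" unfolding T_def by real_asymp
  moreover have "\<forall>\<^sub>F j in sequentially. (T j - C) * ln (T j) - T j \<ge> 0" unfolding T_def by real_asymp
  ultimately have "\<forall>\<^sub>F j in sequentially. False"
  proof eventually_elim
    case (elim j)
    let ?n = "real (extremal j)"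
    have Psi: "mertens_product j * Y j \<le> Psi (extremal j)"
      using C elim by (simp add: Y_def T_def mult.assoc)
    define X where "X = ln (ln ?n)"
    have X1: "X > 1" using elim by (simp only: X_def)
    have V: "X \<le> V j"
      unfolding V_def X_def using elim ln_extremal_le[of j] by (subst ln_le_cancel_iff) auto
    hence "ln X \<le> ln (V j)" using X1 by (subst ln_le_cancel_iff) auto
    with V have den: "X\<^sup>2 * ln X \<le> (V j)\<^sup>2 * ln (V j)"
      using X1 by (intro mult_mono power_mono) auto
    have dpos: "X\<^sup>2 * ln X > 0" using X1 by simp
    have Y0: "0 \<le> mertens_product j * Y j"
      using elim unfolding mertens_product_def Y_def
      by (intro mult_nonneg_nonneg prod_nonneg) (auto dest!: primes_leD)
    have "L j \<le> Psi (extremal j) / (X\<^sup>2 * ln X)"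
      unfolding L_def using Psi den dpos Y0 by (intro frac_le) auto
    also have "\<dots> < c" using elim(2) unfolding elim(3,4) X_def .
    finally show False using elim by simp
  qed
  thus False by simp
qed

theorem theorem1p1:
  "limsup (\<lambda>n::nat. ereal (Psi n / ((loglog (real n))\<^sup>2 * logloglog (real n))))
     = ereal (exp (euler_mascheroni :: real))"
  by (rule antisym[OF limsup_ratio_le limsup_ratio_ge])

end
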